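(* Let $n\ge 2$ be an integer and let $f$ be a complex harmonic mapping on the unit disk with $f\in\mathbf{h}^n$. Then $f\in\mathbf{b}^{2n}$ and $$\|f\|_{\mathbf{b}^{2n}}\le\frac12\csc\left(\frac{\pi}{4n}\right)\|f\|_{\mathbf{h}^n}.$$
   Context: $\mathbf{U}$ is the open unit disk in $\mathbf{C}$, $\mathbf{T}$ the unit circle, $\sigma$ the normalized (probability) arc-length measure on $\mathbf{T}$. For $p>1$, $\mathbf{h}^p$ is the class of complex-valued harmonic functions $f$ on $\mathbf{U}$ with $\|f\|_{\mathbf{h}^p}=\sup_{0<r<1}\left(\int_{\mathbf{T}}|f(r\zeta)|^p\,d\sigma(\zeta)\right)^{1/p}<\infty$. $\mathbf{b}^p$ is the Bergman class of complex-valued harmonic functions $f$ on $\mathbf{U}$ with $\|f\|_{\mathbf{b}^p}=\left(\int_{\mathbf{U}}|f(z)|^p\frac{dx\,dy}{\pi}\right)^{1/p}<\infty$. *)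

theory Defs
  imports "HOL-Analysis.Analysis" "HOL-Probability.Probability"
begin

definition partial_x :: "(complex \<Rightarrow> complex) \<Rightarrow> complex \<Rightarrow> complex" where
  "partial_x f z = vector_derivative (\<lambda>t. f (z + complex_of_real t)) (at 0)"

definition partial_y :: "(complex \<Rightarrow> complex) \<Rightarrow> complex \<Rightarrow> complex" where
  "partial_y f z = vector_derivative (\<lambda>t. f (z + \<i> * complex_of_real t)) (at 0)"

(* Real differentiability throughout: the differentiated functions have domain real.  The
   existence of the partial derivatives is required separately because vector_derivative
   is total. *)
definition C1_on :: "(complex \<Rightarrow> complex) \<Rightarrow> complex set \<Rightarrow> bool" where
  "C1_on f S \<longleftrightarrow>
     (\<forall>z\<in>S. (\<lambda>t::real. f (z + complex_of_real t)) differentiable (at 0) \<and>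
            (\<lambda>t::real. f (z + \<i> * complex_of_real t)) differentiable (at 0)) \<and>
     continuous_on S (partial_x f) \<and> continuous_on S (partial_y f)"

definition C2_on :: "(complex \<Rightarrow> complex) \<Rightarrow> complex set \<Rightarrow> bool" where
  "C2_on f S \<longleftrightarrow> C1_on f S \<and> C1_on (partial_x f) S \<and> C1_on (partial_y f) S"

definition laplacian :: "(complex \<Rightarrow> complex) \<Rightarrow> complex \<Rightarrow> complex" where
  "laplacian f z = partial_x (partial_x f) z + partial_y (partial_y f) z"

definition harmonic_on :: "(complex \<Rightarrow> complex) \<Rightarrow> complex set \<Rightarrow> bool"
    (infixl "(harmonic'_on)" 50) where
  "f harmonic_on S \<longleftrightarrow> open S \<and> C2_on f S \<and> (\<forall>z\<in>S. laplacian f z = 0)"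

abbreviation unit_disc :: "complex set" where
  "unit_disc \<equiv> ball 0 1"

(* Normalized arc length on the unit circle: the image of the uniform distribution of the
   angle.  The underlying space is the circle itself, so that functions need only be
   measurable there. *)
definition arc_measure :: "complex measure" where
  "arc_measure =
     distr (uniform_measure lborel {0..2*pi}) (restrict_space borel (sphere 0 1)) cis"

lemma cis_measurable_circle: "cis \<in> borel \<rightarrow>\<^sub>M restrict_space borel (sphere 0 1)"
  by (rule measurable_restrict_space2)
     (auto intro!: borel_measurable_continuous_onI continuous_intros)

lemma prob_space_arc_measure: "prob_space arc_measure"
  unfolding arc_measure_def
proof (rule prob_space.prob_space_distr)
  show "prob_space (uniform_measure lborel {0..2*pi})"
    by (rule prob_space_uniform_measure) auto
  show "cis \<in> uniform_measure lborel {0..2*pi} \<rightarrow>\<^sub>M restrict_space borel (sphere 0 1)"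
    using cis_measurable_circle by (simp add: measurable_def)
qed

definition integral_mean :: "real \<Rightarrow> (complex \<Rightarrow> complex) \<Rightarrow> real \<Rightarrow> real" where
  "integral_mean p f r =
     (LINT \<zeta>|arc_measure. norm (f (complex_of_real r * \<zeta>)) powr p) powr (1 / p)"

(* For f harmonic (hence continuous) on the disc each integral mean is an integral of a
   bounded continuous function on the circle, so finiteness of the norm is boundedness of
   the means. *)
definition h_space :: "real \<Rightarrow> (complex \<Rightarrow> complex) set" where
  "h_space p = {f. f harmonic_on unit_disc \<and> bdd_above (integral_mean p f ` {0<..<1})}"

definition h_norm :: "real \<Rightarrow> (complex \<Rightarrow> complex) \<Rightarrow> real" where
  "h_norm p f = (SUP r\<in>{0<..<1}. integral_mean p f r)"

definition b_space :: "real \<Rightarrow> (complex \<Rightarrow> complex) set" where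
  "b_space p =
     {f. f harmonic_on unit_disc \<and> set_integrable lborel unit_disc (\<lambda>z. norm (f z) powr p)}"

definition b_norm :: "real \<Rightarrow> (complex \<Rightarrow> complex) \<Rightarrow> real" where
  "b_norm p f = (LINT z:unit_disc|lborel. norm (f z) powr p / pi) powr (1 / p)"

end

theory Submission
  imports Defs "HOL-Complex_Analysis.Complex_Analysis"
begin

text \<open>
  Write \<open>f = g + cnj h\<close> with \<open>g\<close>, \<open>h\<close> holomorphic in the disc and \<open>h 0 = 0\<close>, and put
  \<open>s = |g|\<^sup>2 + |h|\<^sup>2\<close>. The proof compares \<open>f\<close> with \<open>s\<close> twice, with sharp constants, and uses that
  \<open>s\<close>, unlike \<open>|f|\<^sup>2\<close>, is logarithmically subharmonic. Since \<open>|f|\<^sup>2 = s + 2 Re (g h)\<close> and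
  \<open>2 |g h| \<le> s\<close>, both comparisons are statements about one complex number \<open>g h\<close> of size at most
  \<open>s / 2\<close>.

  In the disc, \<open>|f|\<^sup>2\<^sup>n \<le> (1 + cos (\<pi>/2n))\<^sup>n s\<^sup>n + b Re ((2 g h)\<^sup>n)\<close> (\<open>upper_pointwise_inequality\<close>).
  The last term is harmonic and vanishes at \<open>0\<close>, so it integrates to \<open>0\<close> over the disc.

  On the circle, \<open>(1 - cos (\<pi>/n))\<^bsup>n/2\<^esup> s\<^bsup>n/2\<^esup> \<le> |f|\<^sup>n + b' V(-2 g h)\<close>
  (\<open>lower_pointwise_inequality\<close>), where \<open>V\<close> is a superharmonic function on the plane, homogeneous of
  degree \<open>n/2\<close>, that agrees with \<open>Re \<zeta>\<^bsup>n/2\<^esup>\<close> in the sector \<open>|Arg \<zeta>| \<le> 2\<pi>/n\<close>. The mean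
  of \<open>V(-2 g h)\<close> over the circle is at most its value \<open>0\<close> at the centre
  (\<open>circle_mean_superharmonic_power_le_0\<close>).

  The two comparisons are joined by Carleman's isoperimetric inequality, extended to \<open>s\<close>: the integral of
  \<open>s\<^sup>n\<close> over the disc is at most \<open>\<pi>\<close> times the square of the mean of \<open>s\<^bsup>n/2\<^esup>\<close> over the circle
  (\<open>square_sum_isoperimetric\<close>). For a zero-free function one takes a square root and compares Taylor
  coefficients; \<open>s\<close> is majorised by the modulus of such a function with almost the same boundary values.

  The resulting constant is \<open>(1 + cos (\<pi>/2n)) / (1 - cos (\<pi>/n)) = 1 / (4 sin\<^sup>2 (\<pi>/4n))\<close>. All of this
  is applied to the dilates \<open>z \<mapsto> f (r z)\<close>, for which \<open>g\<close> and \<open>h\<close> are holomorphic beyond the closed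
  disc, and Fatou's lemma lets \<open>r\<close> tend to \<open>1\<close>.
\<close>

section \<open>Trigonometric inequalities of contact type\<close>

text \<open>The derivative of \<open>G y + w \<beta> * cos (N * y)\<close>, with \<open>\<beta> = pi / (2 * N)\<close>, is
  \<open>N * (w y - w \<beta> * sin (N * y))\<close>. It vanishes at \<open>\<beta>\<close>, where \<open>sin (N * \<beta>) = 1\<close>. The hypothesis \<open>ratio\<close>
  says that \<open>w y / sin (N * y)\<close> increases, so the derivative changes sign from minus to plus there and \<open>\<beta>\<close>
  is the minimum; at \<open>\<beta>\<close> the cosine term is \<open>0\<close>.\<close>

lemma cosine_contact_inequality:
  fixes N y :: real and G w w' :: "real \<Rightarrow> real"
  assumes N: "0 < N"
    and G: "\<And>x. (G has_real_derivative N * w x) (at x)"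
    and w: "\<And>x. (w has_real_derivative w' x) (at x)"
    and pos: "\<And>x. 0 \<le> x \<Longrightarrow> x \<le> pi / N \<Longrightarrow> 0 \<le> w x"
    and ratio: "\<And>x. 0 < x \<Longrightarrow> x < pi / N \<Longrightarrow> 0 \<le> w' x * sin (N * x) - N * w x * cos (N * x)"
    and w0: "w 0 = 0"
    and y: "0 \<le> y" "y \<le> pi / N"
  shows "G (pi / (2 * N)) \<le> G y + w (pi / (2 * N)) * cos (N * y)"
proof -
  define \<beta> where "\<beta> = pi / (2 * N)"
  have \<beta>: "0 < \<beta>" "\<beta> < pi / N" "N * \<beta> = pi / 2" using N by (auto simp: \<beta>_def field_simps)
  have sinpos: "0 < sin (N * x)" if "0 < x" "x < pi / N" for x
    using that N by (intro sin_gt_zero) (auto simp: field_simps)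
  have mono: "w u / sin (N * u) \<le> w v / sin (N * v)" if uv: "0 < u" "u \<le> v" "v < pi / N" for u v
  proof (rule DERIV_nonneg_imp_nondecreasing[OF uv(2)])
    fix x assume x: "u \<le> x" "x \<le> v"
    have s: "0 < sin (N * x)" using sinpos x uv by auto
    have "((\<lambda>x. w x / sin (N * x)) has_real_derivative
        (w' x * sin (N * x) - w x * (cos (N * x) * N)) / (sin (N * x) * sin (N * x))) (at x)"
      using s by (auto intro!: derivative_eq_intros w)
    moreover have "0 \<le> (w' x * sin (N * x) - w x * (cos (N * x) * N)) / (sin (N * x) * sin (N * x))"
      using ratio[of x] x uv by (intro divide_nonneg_nonneg) (auto simp: mult_ac)
    ultimately show "\<exists>d. ((\<lambda>x. w x / sin (N * x)) has_real_derivative d) (at x) \<and> 0 \<le> d"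
      by blast
  qed
  define k where "k = (\<lambda>x. G x + w \<beta> * cos (N * x))"
  have dk: "(k has_real_derivative N * (w x - w \<beta> * sin (N * x))) (at x)" for x
    unfolding k_def by (auto intro!: derivative_eq_intros G simp: algebra_simps)
  have "k \<beta> \<le> k y"
  proof (cases "y \<le> \<beta>")
    case True
    show ?thesis
    proof (rule DERIV_nonpos_imp_nonincreasing[OF True])
      fix x assume x: "y \<le> x" "x \<le> \<beta>"
      have "w x - w \<beta> * sin (N * x) \<le> 0"
      proof (cases "x = 0")
        case False
        then have "0 < x" using x y by auto
        with mono[of x \<beta>] sinpos[of x] x \<beta> show ?thesis by (simp add: field_simps)
      qed (use w0 in simp)
      then show "\<exists>d. (k has_real_derivative d) (at x) \<and> d \<le> 0"
        using dk[of x] N by (intro exI[of _ "N * (w x - w \<beta> * sin (N * x))"]) (auto simp: mult_le_0_iff)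
    qed
  next
    case False
    then have "\<beta> \<le> y" by simp
    then show ?thesis
    proof (rule DERIV_nonneg_imp_nondecreasing)
      fix x assume x: "\<beta> \<le> x" "x \<le> y"
      have "0 \<le> w x - w \<beta> * sin (N * x)"
      proof (cases "x = pi / N")
        case True
        then show ?thesis using pos[of x] N by auto
      next
        case False
        then have "x < pi / N" using x y by auto
        with mono[of \<beta> x] sinpos[of x] x \<beta> show ?thesis by (simp add: field_simps)
      qed
      then show "\<exists>d. (k has_real_derivative d) (at x) \<and> 0 \<le> d"
        using dk[of x] N by (intro exI[of _ "N * (w x - w \<beta> * sin (N * x))"]) auto
    qed
  qed
  moreover have "k \<beta> = G \<beta>" unfolding k_def \<beta>(3) by simp
  ultimately have "G \<beta> \<le> k y" by simp
  then show ?thesis unfolding k_def \<beta>_def .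
qed

text \<open>The two sides touch at \<open>y = pi / (2 * N)\<close>. With \<open>M = N - 1\<close>, the monotonicity of
  \<open>cos y ^ M * sin y / sin (N * y)\<close> comes down to \<open>M * cos (M * y) * sin y \<le> sin (M * y) * cos y\<close>.\<close>

lemma cos_power_le_contact:
  fixes y :: real
  assumes N: "2 \<le> N" and y: "0 \<le> y" "y \<le> pi / real N"
  shows "cos y ^ N \<le> cos (pi / (2 * real N)) ^ N
           + cos (pi / (2 * real N)) ^ (N - 1) * sin (pi / (2 * real N)) * cos (real N * y)"
proof -
  obtain K where K: "N = Suc (Suc K)" using N by (metis Suc_le_D numeral_2_eq_2 Suc_le_mono)
  define w' where "w' = (\<lambda>x::real. cos x ^ Suc (Suc K) - real (Suc K) * cos x ^ K * sin x ^ 2)"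
  have le2: "pi / real N \<le> pi / 2" using N by (intro divide_left_mono) auto
  have "- (cos (pi / (2 * real N)) ^ N) \<le> - (cos y ^ N)
     + cos (pi / (2 * real N)) ^ Suc K * sin (pi / (2 * real N)) * cos (real N * y)"
  proof (rule cosine_contact_inequality[where w' = w'])
    show "((\<lambda>y. - (cos y ^ N)) has_real_derivative real N * (cos x ^ Suc K * sin x)) (at x)" for x
      unfolding K by (rule derivative_eq_intros refl)+ (cases K; simp add: algebra_simps)
    show "((\<lambda>y. cos y ^ Suc K * sin y) has_real_derivative w' x) (at x)" for x
      unfolding w'_def
      by (rule derivative_eq_intros refl)+ (simp add: power2_eq_square algebra_simps)
    fix x :: real
    show "0 \<le> cos x ^ Suc K * sin x" if "0 \<le> x" "x \<le> pi / real N"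
      using that le2 pi_gt_zero by (intro mult_nonneg_nonneg zero_le_power cos_ge_zero sin_ge_zero) linarith+
    assume x: "0 < x" "x < pi / real N"
    define M where "M = real (Suc K)"
    have M: "1 \<le> M" "real N = M + 1" by (auto simp: M_def K)
    have Mx: "M * x \<le> pi" using x N M by (simp add: field_simps)
    have c: "0 \<le> cos x" using x le2 pi_gt_zero by (intro cos_ge_zero) linarith+
    have "sin (M * 0) * cos 0 - M * cos (M * 0) * sin 0 \<le> sin (M * x) * cos x - M * cos (M * x) * sin x"
    proof (rule DERIV_nonneg_imp_nondecreasing[where f = "\<lambda>x. sin (M * x) * cos x - M * cos (M * x) * sin x"])
      fix z assume z: "0 \<le> z" "z \<le> x"
      have z': "M * z \<le> pi" "z \<le> pi"
        using mult_left_mono[of z x M] z M Mx x le2 pi_gt_zero by linarith+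
      have "((\<lambda>x. sin (M * x) * cos x - M * cos (M * x) * sin x) has_real_derivative
          (M^2 - 1) * (sin (M * z) * sin z)) (at z)"
        by (rule derivative_eq_intros refl)+ (simp add: power2_eq_square algebra_simps)
      moreover have "0 \<le> (M^2 - 1) * (sin (M * z) * sin z)"
        using M z z'
        by (intro mult_nonneg_nonneg sin_ge_zero) auto
      ultimately show "\<exists>d. ((\<lambda>x. sin (M * x) * cos x - M * cos (M * x) * sin x) has_real_derivative d) (at z) \<and> 0 \<le> d"
        by blast
    qed (use x in auto)
    then have D: "0 \<le> sin (M * x) * cos x - M * cos (M * x) * sin x" by simp
    have alg: "P * ((u\<^sup>2 - L * v\<^sup>2) * (S * u + C * v) - (L + 1) * u * v * (C * u - S * v))
        = P * ((S * u - L * C * v) * (u\<^sup>2 + v\<^sup>2))" for P S C L u v :: real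
      by (simp add: power2_eq_square algebra_simps)
    have w'x: "w' x = cos x ^ Suc (Suc K) - M * cos x ^ K * sin x ^ 2"
      by (simp add: w'_def M_def)
    have "w' x * sin (real N * x) - real N * (cos x ^ Suc K * sin x) * cos (real N * x)
       = cos x ^ K * ((cos x ^ 2 - M * sin x ^ 2) * (sin (M * x) * cos x + cos (M * x) * sin x)
           - (M + 1) * cos x * sin x * (cos (M * x) * cos x - sin (M * x) * sin x))"
      by (simp add: w'x M(2) distrib_right sin_add cos_add power2_eq_square algebra_simps)
    also have "\<dots> = cos x ^ K * ((sin (M * x) * cos x - M * cos (M * x) * sin x) * ((cos x)\<^sup>2 + (sin x)\<^sup>2))"
      by (rule alg)
    finally show "0 \<le> w' x * sin (real N * x) - real N * (cos x ^ Suc K * sin x) * cos (real N * x)"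
      using D c by simp
  qed (use N y in auto)
  then show ?thesis by (simp add: K)
qed

text \<open>The counterpart for the sine: here the monotonicity of \<open>sin y ^ M * cos y / sin (N * y)\<close> comes down
  to \<open>cos (M * y) * sin y \<le> M * sin (M * y) * cos y\<close>.\<close>

lemma sin_power_ge_contact:
  fixes y :: real
  assumes N: "2 \<le> N" and y: "0 \<le> y" "y \<le> pi / real N"
  shows "sin (pi / (2 * real N)) ^ N \<le> sin y ^ N
           + sin (pi / (2 * real N)) ^ (N - 1) * cos (pi / (2 * real N)) * cos (real N * y)"
proof -
  obtain K where K: "N = Suc (Suc K)" using N by (metis Suc_le_D numeral_2_eq_2 Suc_le_mono)
  define w' where "w' = (\<lambda>x::real. real (Suc K) * sin x ^ K * cos x ^ 2 - sin x ^ Suc (Suc K))"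
  have le2: "pi / real N \<le> pi / 2" using N by (intro divide_left_mono) auto
  have "sin (pi / (2 * real N)) ^ N \<le> sin y ^ N
     + sin (pi / (2 * real N)) ^ Suc K * cos (pi / (2 * real N)) * cos (real N * y)"
  proof (rule cosine_contact_inequality[where w' = w'])
    show "((\<lambda>y. sin y ^ N) has_real_derivative real N * (sin x ^ Suc K * cos x)) (at x)" for x
      unfolding K by (rule derivative_eq_intros refl)+ (cases K; simp add: algebra_simps)
    show "((\<lambda>y. sin y ^ Suc K * cos y) has_real_derivative w' x) (at x)" for x
      unfolding w'_def
      by (rule derivative_eq_intros refl)+ (simp add: power2_eq_square algebra_simps)
    fix x :: real
    show "0 \<le> sin x ^ Suc K * cos x" if "0 \<le> x" "x \<le> pi / real N"
      using that le2 pi_gt_zero by (intro mult_nonneg_nonneg zero_le_power cos_ge_zero sin_ge_zero) linarith+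
    assume x: "0 < x" "x < pi / real N"
    define M where "M = real (Suc K)"
    have M: "1 \<le> M" "real N = M + 1" by (auto simp: M_def K)
    have Mx: "M * x \<le> pi" using x N M by (simp add: field_simps)
    have xM: "x \<le> M * x" using mult_right_mono[OF M(1), of x] x by simp
    have c: "0 \<le> cos x" using x le2 pi_gt_zero by (intro cos_ge_zero) linarith+
    have s: "0 \<le> sin x" using x le2 pi_gt_zero by (intro sin_ge_zero) linarith+
    have S: "0 \<le> sin (M * x)" using x Mx M by (intro sin_ge_zero) auto
    have D: "0 \<le> M * sin (M * x) * cos x - cos (M * x) * sin x"
    proof (cases "M * x \<le> pi / 2")
      case True
      have "cos (M * x) * sin x \<le> cos x * sin (M * x)"
        using True xM x c s pi_gt_zero
        by (intro mult_mono cos_monotone_0_pi_le sin_monotone_2pi_le) linarith+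
      also have "\<dots> \<le> M * (cos x * sin (M * x))"
        using mult_right_mono[OF M(1), of "cos x * sin (M * x)"] c S by simp
      finally show ?thesis by (simp add: mult_ac)
    next
      case False
      then have "cos (M * x) \<le> 0" using cos_monotone_0_pi_le[of "pi / 2" "M * x"] Mx by simp
      then have "cos (M * x) * sin x \<le> 0" using s by (simp add: mult_nonpos_nonneg)
      moreover have "0 \<le> M * sin (M * x) * cos x" using c S M by simp
      ultimately show ?thesis by linarith
    qed
    have alg: "P * ((L * u\<^sup>2 - v\<^sup>2) * (S * u + C * v) - (L + 1) * u * v * (C * u - S * v))
        = P * ((L * S * u - C * v) * (u\<^sup>2 + v\<^sup>2))" for P S C L u v :: real
      by (simp add: power2_eq_square algebra_simps)
    have w'x: "w' x = M * sin x ^ K * cos x ^ 2 - sin x ^ Suc (Suc K)"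
      by (simp add: w'_def M_def)
    have "w' x * sin (real N * x) - real N * (sin x ^ Suc K * cos x) * cos (real N * x)
       = sin x ^ K * ((M * cos x ^ 2 - sin x ^ 2) * (sin (M * x) * cos x + cos (M * x) * sin x)
           - (M + 1) * cos x * sin x * (cos (M * x) * cos x - sin (M * x) * sin x))"
      by (simp add: w'x M(2) distrib_right sin_add cos_add power2_eq_square algebra_simps)
    also have "\<dots> = sin x ^ K * ((M * sin (M * x) * cos x - cos (M * x) * sin x) * ((cos x)\<^sup>2 + (sin x)\<^sup>2))"
      by (rule alg)
    finally show "0 \<le> w' x * sin (real N * x) - real N * (sin x ^ Suc K * cos x) * cos (real N * x)"
      using D s by simp
  qed (use N y in auto)
  then show ?thesis by (simp add: K)
qed

section \<open>Pointwise inequalities between the harmonic and the holomorphic modulus\<close>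

text \<open>Moving \<open>\<zeta> = t * cis \<phi>\<close> vertically away from the real axis until it reaches the unit circle at
  \<open>cis \<phi>'\<close> decreases \<open>Re (\<zeta> powr q)\<close>, because \<open>cos (q * x) / cos x powr q\<close> is decreasing in \<open>x\<close>. This
  reduces inequalities involving \<open>Re \<zeta>\<close> and \<open>Re (\<zeta> powr q)\<close> in the disc to the circle.\<close>

lemma cos_multiple_shift:
  fixes q t \<phi> \<phi>' :: real
  assumes q: "1 \<le> q" and t: "0 \<le> t" "t \<le> 1"
    and \<phi>: "0 \<le> \<phi>" "\<phi> \<le> pi / 2" and \<phi>': "0 \<le> \<phi>'" "\<phi>' \<le> pi / 2" "q * \<phi>' \<le> pi"
    and eq: "cos \<phi>' = t * cos \<phi>"
  shows "cos (q * \<phi>') \<le> t powr q * cos (q * \<phi>)"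
proof (cases "cos \<phi>' = 0")
  case True
  then have p': "\<phi>' = pi / 2"
    using \<phi>' cos_gt_zero_pi[of \<phi>'] pi_gt_zero by (cases "\<phi>' < pi / 2") auto
  have neg: "cos (q * (pi / 2)) \<le> 0"
    using cos_monotone_0_pi_le[of "pi / 2" "q * (pi / 2)"] q \<phi>'(3) p' mult_right_mono[OF q, of "pi / 2"] by simp
  from True eq have "t = 0 \<or> cos \<phi> = 0" by simp
  then show ?thesis
  proof
    assume "t = 0" then show ?thesis using neg unfolding p' by simp
  next
    assume "cos \<phi> = 0"
    then have p: "\<phi> = pi / 2"
      using \<phi> cos_gt_zero_pi[of \<phi>] pi_gt_zero by (cases "\<phi> < pi / 2") auto
    moreover have "t powr q \<le> 1" using t q by (intro powr_le1) auto
    ultimately show ?thesis using neg mult_right_mono_neg[of "t powr q" 1 "cos (q * (pi / 2))"] unfolding p p' by simp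
  qed
next
  case False
  then have p': "\<phi>' < pi / 2" using \<phi>' by (cases "\<phi>' = pi / 2") auto
  have c': "0 < cos \<phi>'" using p' \<phi>' pi_gt_zero by (intro cos_gt_zero_pi) linarith+
  then have c: "0 < cos \<phi>" using eq t by (simp add: zero_less_mult_iff)
  have "cos \<phi>' \<le> cos \<phi>" using eq t c mult_right_mono[of t 1 "cos \<phi>"] by simp
  then have le: "\<phi> \<le> \<phi>'" using \<phi> \<phi>' pi_gt_zero by (subst (asm) cos_mono_le_eq) auto
  have "cos (q * \<phi>') * cos \<phi>' powr (- q) \<le> cos (q * \<phi>) * cos \<phi> powr (- q)"
  proof (rule DERIV_nonpos_imp_nonincreasing[OF le, of "\<lambda>x. cos (q * x) * cos x powr (- q)"])
    fix x assume x: "\<phi> \<le> x" "x \<le> \<phi>'"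
    have cx: "0 < cos x" using x p' \<phi> pi_gt_zero by (intro cos_gt_zero_pi) linarith+
    have "((\<lambda>x. cos (q * x) * cos x powr (- q)) has_real_derivative
        - (q * cos x powr (- q - 1) * sin ((q - 1) * x))) (at x)"
      by (rule derivative_eq_intros refl cx)+
        (use cx in \<open>simp add: left_diff_distrib sin_diff powr_diff field_simps\<close>)
    moreover have "(q - 1) * x \<le> q * \<phi>'" using q x \<phi> by (intro mult_mono) auto
    then have "0 \<le> q * cos x powr (- q - 1) * sin ((q - 1) * x)"
      using q x \<phi> \<phi>'(3) by (intro mult_nonneg_nonneg sin_ge_zero) auto
    ultimately show "\<exists>d. ((\<lambda>x. cos (q * x) * cos x powr (- q)) has_real_derivative d) (at x) \<and> d \<le> 0"
      by (intro exI[of _ "- (q * cos x powr (- q - 1) * sin ((q - 1) * x))"]) auto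
  qed
  then have "cos (q * \<phi>') \<le> cos (q * \<phi>) * (cos \<phi>' powr q * cos \<phi> powr (- q))"
    using c c' by (simp add: powr_minus field_simps)
  also have "cos \<phi>' powr q * cos \<phi> powr (- q) = t powr q"
    using c t unfolding eq by (simp add: powr_mult powr_minus)
  finally show ?thesis by (simp add: mult.commute)
qed

text \<open>Where \<open>\<theta> \<le> pi / n\<close> and \<open>cos (pi / n) \<le> t * cos \<theta>\<close>, \<open>cos_multiple_shift\<close> reduces the claim to
  \<open>t = 1\<close>, which is \<open>cos_power_le_contact\<close> with \<open>N = 2 * n\<close> and \<open>y = \<theta> / 2\<close>. Elsewhere
  \<open>t * cos \<theta> \<le> cos (pi / n)\<close>, so the left-hand side is at most its value at \<open>t = 1\<close>, \<open>\<theta> = pi / n\<close>,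
  where the cosine on the right has already reached its minimum \<open>-1\<close>.\<close>

lemma upper_inequality_polar:
  fixes t \<theta> :: real
  assumes n: "2 \<le> n" and t: "0 \<le> t" "t \<le> 1" and \<theta>: "0 \<le> \<theta>" "\<theta> \<le> pi"
  defines "c \<equiv> cos (pi / (2 * real n))"
  defines "b \<equiv> (1 + c) ^ (n - 1) * sin (pi / (2 * real n))"
  shows "(1 + t * cos \<theta>) ^ n \<le> (1 + c) ^ n + b * (t ^ n * cos (real n * \<theta>))"
proof -
  define \<beta> where "\<beta> = pi / (4 * real n)"
  have \<beta>: "pi / (2 * real (2 * n)) = \<beta>" "pi / (2 * real n) = 2 * \<beta>" by (auto simp: \<beta>_def)
  have c: "1 + c = 2 * cos \<beta> ^ 2" unfolding c_def \<beta>(2) by (simp add: cos_double_cos)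
  obtain m where m: "n = Suc m" using n by (cases n) auto
  have b: "b = 2 ^ n * (cos \<beta> ^ (2 * n - 1) * sin \<beta>)"
    unfolding b_def c \<beta>(2) by (simp add: m sin_double power_mult_distrib power_mult[symmetric])
  have b0: "0 \<le> b"
    unfolding b_def c \<beta>(2) using n
    by (intro mult_nonneg_nonneg sin_ge_zero) (auto simp: \<beta>_def field_simps)
  have rim: "(1 + cos \<psi>) ^ n \<le> (1 + c) ^ n + b * cos (real n * \<psi>)"
    if "0 \<le> \<psi>" "\<psi> \<le> pi / real n" for \<psi>
  proof -
    have "cos (\<psi> / 2) ^ (2 * n) \<le> cos \<beta> ^ (2 * n) + cos \<beta> ^ (2 * n - 1) * sin \<beta> * cos (real (2 * n) * (\<psi> / 2))"
      using cos_power_le_contact[of "2 * n" "\<psi> / 2"] that n unfolding \<beta>(1) by simp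
    then have "2 ^ n * cos (\<psi> / 2) ^ (2 * n)
        \<le> 2 ^ n * (cos \<beta> ^ (2 * n) + cos \<beta> ^ (2 * n - 1) * sin \<beta> * cos (real n * \<psi>))"
      by (intro mult_left_mono) auto
    moreover have "1 + cos \<psi> = 2 * cos (\<psi> / 2) ^ 2" using cos_double_cos[of "\<psi> / 2"] by simp
    ultimately show ?thesis unfolding b c by (simp add: power_mult_distrib power_mult[symmetric] distrib_left mult_ac)
  qed
  have pn: "0 < pi / real n" "pi / real n \<le> pi / 2" using n by (simp, intro divide_left_mono) auto
  have cpn: "0 \<le> cos (pi / real n)" using pn by (intro cos_ge_zero) linarith+
  show ?thesis
  proof (cases "\<theta> \<le> pi / real n \<and> cos (pi / real n) \<le> t * cos \<theta>")
    case True
    have le1: "t * cos \<theta> \<le> 1" using mult_left_mono[OF cos_le_one[of \<theta>] t(1)] t(2) by linarith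
    define \<psi> where "\<psi> = arccos (t * cos \<theta>)"
    have cos\<psi>: "cos \<psi> = t * cos \<theta>" unfolding \<psi>_def using True cpn le1 by (intro cos_arccos) linarith+
    have \<psi>: "0 \<le> \<psi>" "\<psi> \<le> pi / real n"
    proof -
      show "0 \<le> \<psi>" unfolding \<psi>_def using True cpn le1 by (intro arccos_lbound) linarith+
      have "arccos (t * cos \<theta>) \<le> arccos (cos (pi / real n))"
        using True cpn le1 by (intro arccos_le_arccos) linarith+
      also have "\<dots> = pi / real n" using pn by (intro arccos_cos) linarith+
      finally show "\<psi> \<le> pi / real n" unfolding \<psi>_def .
    qed
    have "cos (real n * \<psi>) \<le> t powr real n * cos (real n * \<theta>)"
    proof (rule cos_multiple_shift)
      show "real n * \<psi> \<le> pi" using \<psi> n by (simp add: field_simps)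
      show "\<theta> \<le> pi / 2" "\<psi> \<le> pi / 2" using True \<psi> pn by linarith+
    qed (use n t \<theta> \<psi> cos\<psi> in auto)
    also have "t powr real n = t ^ n" using n t by (intro powr_realpow') auto
    finally have "b * cos (real n * \<psi>) \<le> b * (t ^ n * cos (real n * \<theta>))" by (intro mult_left_mono b0)
    with rim[OF \<psi>] show ?thesis unfolding cos\<psi> by linarith
  next
    case False
    have le: "t * cos \<theta> \<le> cos (pi / real n)"
    proof (cases "\<theta> \<le> pi / real n")
      case F: False
      then have "cos \<theta> \<le> cos (pi / real n)" using \<theta> pn by (intro cos_monotone_0_pi_le) auto
      then have "t * cos \<theta> \<le> t * cos (pi / real n)" using t by (intro mult_left_mono)
      also have "\<dots> \<le> cos (pi / real n)" using t cpn by (simp add: mult_left_le_one_le)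
      finally show ?thesis .
    qed (use False in auto)
    have "\<bar>t * cos \<theta>\<bar> \<le> 1" using t by (simp add: abs_mult mult_le_one)
    then have "(1 + t * cos \<theta>) ^ n \<le> (1 + cos (pi / real n)) ^ n" using le by (intro power_mono) auto
    also have "\<dots> \<le> (1 + c) ^ n + b * cos pi"
      using rim[of "pi / real n"] pn n by simp
    also have "\<dots> = (1 + c) ^ n + b * (- 1)" by simp
    also have "\<dots> \<le> (1 + c) ^ n + b * (t ^ n * cos (real n * \<theta>))"
    proof -
      have "\<bar>t ^ n * cos (real n * \<theta>)\<bar> \<le> 1" using t by (simp add: abs_mult mult_le_one power_le_one)
      then show ?thesis using b0 by (intro add_left_mono mult_left_mono) auto
    qed
    finally show ?thesis .
  qed
qed

text \<open>On the circle \<open>t = 1\<close> this is \<open>sin_power_ge_contact\<close> with \<open>y = \<phi> / 2\<close> up to \<open>\<phi> = 2 * pi / n\<close>, where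
  the cosine reaches \<open>-1\<close>; it is kept at that value for larger angles, while the first summand on the right
  still grows. For \<open>\<phi> \<le> pi / 2\<close>, \<open>cos_multiple_shift\<close> reduces the claim to the circle.\<close>

lemma lower_inequality_polar:
  fixes t \<phi> :: real
  assumes n: "2 \<le> n" and t: "0 \<le> t" "t \<le> 1" and \<phi>: "0 \<le> \<phi>" "\<phi> \<le> pi"
  defines "q \<equiv> real n / 2" and "\<kappa> \<equiv> 1 - cos (pi / real n)"
  defines "b \<equiv> \<kappa> powr q * cot (pi / (2 * real n))"
  shows "\<kappa> powr q \<le> (1 - t * cos \<phi>) powr q + b * (t powr q * cos (min (q * \<phi>) pi))"
proof -
  define \<gamma> where "\<gamma> = pi / (2 * real n)"
  have pn: "0 < pi / real n" "pi / real n \<le> pi / 2" using n by (simp, intro divide_left_mono) auto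
  have g3: "pi / real n = 2 * \<gamma>" by (simp add: \<gamma>_def)
  have g: "0 < \<gamma>" "\<gamma> < pi / 2" using pn pi_gt_zero unfolding g3 by linarith+
  have sg: "0 < sin \<gamma>" "0 < cos \<gamma>" using g by (auto intro: sin_gt_zero cos_gt_zero)
  have q: "1 \<le> q" using n by (simp add: q_def)
  have vers: "1 - cos (2 * x) = 2 * sin x ^ 2" for x :: real by (simp add: cos_double_sin)
  have pow: "(1 - cos (2 * x)) powr q = 2 powr q * sin x ^ n" if "0 \<le> sin x" for x :: real
  proof -
    have "(sin x ^ 2) powr q = sin x ^ n"
    proof (cases "sin x = 0")
      case False
      then have "(sin x ^ 2) powr q = (sin x powr 2) powr q" using that by (simp add: powr_numeral)
      also have "\<dots> = sin x powr real n" by (simp add: powr_powr q_def)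
      finally show ?thesis using False that by (simp add: powr_realpow)
    qed (use n in auto)
    then show ?thesis unfolding vers by (simp add: powr_mult)
  qed
  have \<kappa>: "\<kappa> powr q = 2 powr q * sin \<gamma> ^ n" unfolding \<kappa>_def g3 using sg by (intro pow) auto
  have b: "b = 2 powr q * (sin \<gamma> ^ (n - 1) * cos \<gamma>)"
    unfolding b_def \<kappa> \<gamma>_def[symmetric] cot_def using sg n by (cases n) auto
  have b0: "0 \<le> b" unfolding b using sg by simp
  have rim: "\<kappa> powr q \<le> (1 - cos \<psi>) powr q + b * cos (min (q * \<psi>) pi)"
    if \<psi>: "0 \<le> \<psi>" "\<psi> \<le> pi" for \<psi>
  proof -
    have *: "\<kappa> powr q \<le> (1 - cos \<psi>) powr q + b * cos (q * \<psi>)"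
      if "0 \<le> \<psi>" "\<psi> \<le> 2 * pi / real n" for \<psi>
    proof -
      have "sin \<gamma> ^ n \<le> sin (\<psi> / 2) ^ n + sin \<gamma> ^ (n - 1) * cos \<gamma> * cos (real n * (\<psi> / 2))"
        unfolding \<gamma>_def by (rule sin_power_ge_contact[OF n]) (use that in \<open>auto simp: mult.commute\<close>)
      then have "2 powr q * sin \<gamma> ^ n
          \<le> 2 powr q * (sin (\<psi> / 2) ^ n + sin \<gamma> ^ (n - 1) * cos \<gamma> * cos (real n * (\<psi> / 2)))"
        by (intro mult_left_mono) auto
      moreover have "2 * pi / real n = 2 * (pi / real n)" by simp
      then have "0 \<le> sin (\<psi> / 2)" using that pn by (intro sin_ge_zero) linarith+
      then have "(1 - cos \<psi>) powr q = 2 powr q * sin (\<psi> / 2) ^ n" using pow[of "\<psi> / 2"] by simp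
      ultimately show ?thesis unfolding \<kappa> b by (simp add: q_def algebra_simps)
    qed
    show ?thesis
    proof (cases "\<psi> \<le> 2 * pi / real n")
      case True
      then have "q * \<psi> \<le> pi" using n by (simp add: q_def field_simps)
      then show ?thesis using *[of \<psi>] True \<psi> by (simp add: min_def)
    next
      case False
      then have mi: "min (q * \<psi>) pi = pi" using n by (simp add: q_def field_simps min_def)
      have qe: "q * (2 * pi / real n) = pi" using n by (simp add: q_def)
      have "\<kappa> powr q \<le> (1 - cos (2 * pi / real n)) powr q + b * cos pi"
        using *[of "2 * pi / real n"] unfolding qe by simp
      also have "(1 - cos (2 * pi / real n)) powr q \<le> (1 - cos \<psi>) powr q"
        using False \<psi> q by (intro powr_mono2) (auto intro!: cos_monotone_0_pi_le)
      finally show ?thesis unfolding mi by simp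
    qed
  qed
  show ?thesis
  proof (cases "\<phi> \<le> pi / 2")
    case True
    have c0: "0 \<le> t * cos \<phi>" using t True \<phi> by (intro mult_nonneg_nonneg cos_ge_zero) auto
    have le1: "t * cos \<phi> \<le> 1" using mult_left_mono[OF cos_le_one[of \<phi>] t(1)] t(2) by linarith
    define \<psi> where "\<psi> = arccos (t * cos \<phi>)"
    have cos\<psi>: "cos \<psi> = t * cos \<phi>" unfolding \<psi>_def using c0 le1 by (intro cos_arccos) linarith+
    have \<psi>: "0 \<le> \<psi>" "\<psi> \<le> pi / 2"
      unfolding \<psi>_def using c0 le1 arccos_lbound[of "t * cos \<phi>"] arccos_le_pi2[of "t * cos \<phi>"] by linarith+
    have "cos (min (q * \<psi>) pi) \<le> t powr q * cos (min (q * \<phi>) pi)"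
    proof (cases "q * \<psi> \<le> pi")
      case F: True
      have "cos \<psi> \<le> cos \<phi>" using t c0 cos\<psi> mult_left_le_one_le[of "cos \<phi>" t] cos_ge_zero[of \<phi>] True \<phi> by simp
      then have "\<phi> \<le> \<psi>" using \<phi> \<psi> pi_gt_zero by (subst (asm) cos_mono_le_eq) auto
      then have "q * \<phi> \<le> q * \<psi>" using q by (intro mult_left_mono) auto
      then show ?thesis
        using cos_multiple_shift[OF q t \<phi>(1) True \<psi> F cos\<psi>] F by (simp add: min_def)
    next
      case False
      have "t powr q \<le> 1" using t q by (intro powr_le1) auto
      then have "\<bar>t powr q * cos (min (q * \<phi>) pi)\<bar> \<le> 1" by (simp add: abs_mult mult_le_one)
      then show ?thesis using False by (simp add: min_def)
    qed
    then have "b * cos (min (q * \<psi>) pi) \<le> b * (t powr q * cos (min (q * \<phi>) pi))" using b0 by (intro mult_left_mono)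
    then show ?thesis using rim[of \<psi>] \<psi> pi_gt_zero unfolding cos\<psi> by linarith
  next
    case False
    then have cneg: "cos \<phi> \<le> 0" using cos_monotone_0_pi_le[of "pi / 2" \<phi>] \<phi> by simp
    have one: "1 \<le> (1 - t * cos \<phi>) powr q"
      using cneg t q by (intro ge_one_powr_ge_zero) (auto simp: mult_nonneg_nonpos)
    have "t powr q \<le> 1" using t q by (intro powr_le1) auto
    then have "\<bar>t powr q * cos (min (q * \<phi>) pi)\<bar> \<le> 1" by (simp add: abs_mult mult_le_one)
    then have "b * (- 1) \<le> b * (t powr q * cos (min (q * \<phi>) pi))" using b0 by (intro mult_left_mono) auto
    then have suff: ?thesis if "\<kappa> powr q + b \<le> 1" using that one by linarith
    \<comment> \<open>In this half-plane the first summand is at least \<open>1\<close> and the second at least \<open>-b\<close>, so \<open>\<kappa> powr q + b \<le> 1\<close>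
      suffices. For \<open>n \<ge> 4\<close> this is the case \<open>\<phi> = pi / 2\<close> on the circle, and for \<open>n = 3\<close> it is numerical. It
      fails for \<open>n = 2\<close>, where the two sides of the claim are equal.\<close>
    consider "n = 2" | "n = 3" | "4 \<le> n" using n by linarith
    then show ?thesis
    proof cases
      case 1
      have g4: "\<gamma> = pi / 4" by (simp add: \<gamma>_def 1)
      have "b = 1" unfolding b g4 by (simp add: q_def 1 sin_45 cos_45)
      then show ?thesis using t \<phi> cneg 1 by (simp add: q_def \<kappa>_def min_def mult_nonneg_nonpos)
    next
      case 2
      have g6: "\<gamma> = pi / 6" by (simp add: \<gamma>_def 2)
      have "(2::real) powr q = 2 powr 1 * 2 powr (1 / 2)" unfolding powr_add[symmetric] by (simp add: q_def 2)
      then have "2 powr q = 2 * sqrt 2" by (simp add: powr_half_sqrt)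
      then have "\<kappa> powr q + b = (sqrt 2 + sqrt 2 * sqrt 3) / 4"
        unfolding \<kappa> b g6 2 by (simp add: sin_30 cos_30 power2_eq_square power3_eq_cube field_simps)
      also have "\<dots> = (sqrt 2 + sqrt 6) / 4" by (simp add: real_sqrt_mult[symmetric])
      also have "\<dots> \<le> (1.5 + 2.5) / 4"
        by (intro divide_right_mono add_mono real_le_lsqrt) (auto simp: power2_eq_square)
      finally show ?thesis by (intro suff) simp
    next
      case 3
      then have "pi \<le> q * (pi / 2)" by (simp add: q_def field_simps)
      then have "min (q * (pi / 2)) pi = pi" by simp
      then have "\<kappa> powr q + b \<le> 1" using rim[of "pi / 2"] by simp
      then show ?thesis by (rule suff)
    qed
  qed
qed

lemma Re_eq_norm_cos_abs_Arg: "Re \<zeta> = norm \<zeta> * cos \<bar>Arg \<zeta>\<bar>"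
proof -
  have "Re \<zeta> = Re (rcis (norm \<zeta>) (Arg \<zeta>))" by (simp only: rcis_cmod_Arg)
  then show ?thesis by (simp add: rcis_def)
qed

lemma Re_power_eq_norm_cos_abs_Arg: "Re (\<zeta> ^ n) = norm \<zeta> ^ n * cos (real n * \<bar>Arg \<zeta>\<bar>)"
proof -
  have "\<zeta> ^ n = rcis (norm \<zeta>) (Arg \<zeta>) ^ n" by (simp only: rcis_cmod_Arg)
  also have "\<dots> = rcis (norm \<zeta> ^ n) (real n * Arg \<zeta>)" by (rule DeMoivre2)
  finally have "Re (\<zeta> ^ n) = norm \<zeta> ^ n * cos (real n * Arg \<zeta>)" by (simp add: rcis_def)
  also have "cos (real n * Arg \<zeta>) = cos (real n * \<bar>Arg \<zeta>\<bar>)" by (simp add: abs_if)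
  finally show ?thesis .
qed

lemma abs_Arg_le_pi: "\<bar>Arg \<zeta>\<bar> \<le> pi"
  using Arg_bounded[of \<zeta>] by linarith

lemma upper_pointwise_inequality:
  fixes \<zeta> :: complex
  assumes n: "2 \<le> n" and s: "norm \<zeta> \<le> s"
  defines "c \<equiv> cos (pi / (2 * real n))"
  shows "(s + Re \<zeta>) ^ n \<le> (1 + c) ^ n * s ^ n
           + (1 + c) ^ (n - 1) * sin (pi / (2 * real n)) * Re (\<zeta> ^ n)"
proof (cases "s = 0")
  case True
  then show ?thesis using n s by (simp add: zero_power)
next
  case False
  then have s0: "0 < s" using s norm_ge_zero[of \<zeta>] by linarith
  define t where "t = norm \<zeta> / s"
  have nz: "norm \<zeta> = s * t" using s0 by (simp add: t_def)
  have "(1 + t * cos \<bar>Arg \<zeta>\<bar>) ^ n \<le> (1 + c) ^ n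
      + (1 + c) ^ (n - 1) * sin (pi / (2 * real n)) * (t ^ n * cos (real n * \<bar>Arg \<zeta>\<bar>))"
    unfolding c_def using s s0 by (intro upper_inequality_polar n abs_Arg_le_pi) (auto simp: t_def)
  then have "s ^ n * (1 + t * cos \<bar>Arg \<zeta>\<bar>) ^ n \<le> s ^ n * ((1 + c) ^ n
      + (1 + c) ^ (n - 1) * sin (pi / (2 * real n)) * (t ^ n * cos (real n * \<bar>Arg \<zeta>\<bar>)))"
    using s0 by (intro mult_left_mono) auto
  moreover have "s ^ n * (1 + t * cos \<bar>Arg \<zeta>\<bar>) ^ n = (s + Re \<zeta>) ^ n"
    by (subst Re_eq_norm_cos_abs_Arg) (simp add: nz power_mult_distrib[symmetric] algebra_simps)
  ultimately show ?thesis
    by (simp add: Re_power_eq_norm_cos_abs_Arg nz power_mult_distrib algebra_simps)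
qed

text \<open>The function equals \<open>Re (\<zeta> powr q)\<close> in the sector \<open>q * \<bar>Arg \<zeta>\<bar> \<le> pi\<close> and
  \<open>- (norm \<zeta> powr q)\<close> outside it. Freezing the angular factor at its minimum \<open>-1\<close> makes the function single-valued
  for every real \<open>q\<close> and keeps it superharmonic when \<open>q \<ge> 1\<close>.\<close>

definition superharmonic_power :: "real \<Rightarrow> complex \<Rightarrow> real" where
  "superharmonic_power q \<zeta> = norm \<zeta> powr q * cos (min (q * \<bar>Arg \<zeta>\<bar>) pi)"

lemma lower_pointwise_inequality:
  fixes \<zeta> :: complex
  assumes n: "2 \<le> n" and s: "norm \<zeta> \<le> s"
  defines "q \<equiv> real n / 2" and "\<kappa> \<equiv> 1 - cos (pi / real n)"
  shows "\<kappa> powr q * s powr q \<le> (s - Re \<zeta>) powr q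
           + \<kappa> powr q * cot (pi / (2 * real n)) * superharmonic_power q \<zeta>"
proof (cases "s = 0")
  case True
  then show ?thesis using s n by (simp add: superharmonic_power_def q_def)
next
  case False
  then have s0: "0 < s" using s norm_ge_zero[of \<zeta>] by linarith
  define t where "t = norm \<zeta> / s"
  have nz: "norm \<zeta> = s * t" using s0 by (simp add: t_def)
  have t: "0 \<le> t" "t \<le> 1" using s s0 by (auto simp: t_def)
  define \<phi> where "\<phi> = \<bar>Arg \<zeta>\<bar>"
  define B where "B = \<kappa> powr q * cot (pi / (2 * real n))"
  have "\<kappa> powr q \<le> (1 - t * cos \<phi>) powr q + B * (t powr q * cos (min (q * \<phi>) pi))"
    unfolding q_def \<kappa>_def B_def \<phi>_def by (rule lower_inequality_polar[OF n t]) (auto simp: abs_Arg_le_pi)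
  then have "s powr q * \<kappa> powr q
      \<le> s powr q * ((1 - t * cos \<phi>) powr q + B * (t powr q * cos (min (q * \<phi>) pi)))"
    by (intro mult_left_mono) auto
  moreover have "s powr q * (1 - t * cos \<phi>) powr q = (s - Re \<zeta>) powr q"
  proof -
    have "t * cos \<phi> \<le> 1" using mult_left_mono[OF cos_le_one[of \<phi>] t(1)] t(2) by linarith
    then have "s powr q * (1 - t * cos \<phi>) powr q = (s * (1 - t * cos \<phi>)) powr q"
      using s0 by (subst powr_mult) auto
    also have "s * (1 - t * cos \<phi>) = s - Re \<zeta>"
      by (subst Re_eq_norm_cos_abs_Arg) (simp add: nz \<phi>_def algebra_simps)
    finally show ?thesis .
  qed
  moreover have "norm \<zeta> powr q = s powr q * t powr q" unfolding nz using s0 t by (simp add: powr_mult)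
  ultimately show ?thesis
    unfolding superharmonic_power_def B_def[symmetric] \<phi>_def[symmetric] by (simp add: algebra_simps)
qed

section \<open>Means over the unit circle\<close>

lemma uniform_angle_measure:
  "uniform_measure lborel {0..2 * pi} = density lborel (\<lambda>x. ennreal (indicator {0..2 * pi} x / (2 * pi)))"
proof -
  have "(indicator {0..2 * pi} x :: ennreal) / emeasure lborel {0..2 * pi} = ennreal (indicator {0..2 * pi} x / (2 * pi))" for x :: real
    using divide_ennreal[of 1 "2 * pi"] by (auto simp: indicator_def)
  then show ?thesis unfolding uniform_measure_def by simp
qed

lemma borel_measurable_circle:
  fixes \<phi> :: "complex \<Rightarrow> 'b::{banach, second_countable_topology}"
  assumes "continuous_on (sphere 0 1) \<phi>"
  shows "\<phi> \<in> borel_measurable (restrict_space borel (sphere 0 1))"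
  using assms by (intro borel_measurable_continuous_on_restrict)

lemma cis_measurable_uniform: "cis \<in> uniform_measure lborel {0..2 * pi} \<rightarrow>\<^sub>M restrict_space borel (sphere 0 1)"
  using cis_measurable_circle by (simp add: measurable_def)

lemma integrable_arc_measure:
  fixes \<phi> :: "complex \<Rightarrow> 'b::{banach, second_countable_topology}"
  assumes \<phi>: "continuous_on (sphere 0 1) \<phi>"
  shows "integrable arc_measure \<phi>"
proof -
  interpret prob_space arc_measure by (rule prob_space_arc_measure)
  have "bounded (\<phi> ` sphere 0 1)" using \<phi> by (intro compact_imp_bounded compact_continuous_image) auto
  then obtain B where "\<forall>y\<in>\<phi> ` sphere 0 1. norm y \<le> B" unfolding bounded_iff by blast
  then have B: "\<And>z. z \<in> sphere 0 1 \<Longrightarrow> norm (\<phi> z) \<le> B" by blast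
  show ?thesis
  proof (rule integrable_const_bound)
    show "\<phi> \<in> borel_measurable arc_measure"
      using borel_measurable_circle[OF \<phi>] by (simp add: arc_measure_def)
    show "AE x in arc_measure. norm (\<phi> x) \<le> B"
      using B by (intro AE_I2) (simp add: arc_measure_def space_restrict_space)
  qed
qed

lemma integral_arc_measure:
  fixes \<phi> :: "complex \<Rightarrow> 'b::euclidean_space"
  assumes \<phi>: "continuous_on (sphere 0 1) \<phi>"
  shows "(LINT \<zeta>|arc_measure. \<phi> \<zeta>) = integral {0..2 * pi} (\<lambda>t. \<phi> (cis t)) /\<^sub>R (2 * pi)"
proof -
  have \<phi>c: "continuous_on {0..2 * pi} (\<lambda>t. \<phi> (cis t))"
    by (intro continuous_on_compose2[OF \<phi>] continuous_intros) auto
  have [measurable]: "(\<lambda>t. \<phi> (cis t)) \<in> borel_measurable lborel"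
    using measurable_compose[OF cis_measurable_circle borel_measurable_circle[OF \<phi>]] by simp
  have "(LINT \<zeta>|arc_measure. \<phi> \<zeta>) = (LINT t|uniform_measure lborel {0..2 * pi}. \<phi> (cis t))"
    unfolding arc_measure_def
    by (rule integral_distr[OF cis_measurable_uniform borel_measurable_circle[OF \<phi>]])
  also have "\<dots> = (LINT t|lborel. (indicator {0..2 * pi} t / (2 * pi)) *\<^sub>R \<phi> (cis t))"
    unfolding uniform_angle_measure by (rule integral_density) auto
  also have "\<dots> = (LINT t|lborel. inverse (2 * pi) *\<^sub>R (indicator {0..2 * pi} t *\<^sub>R \<phi> (cis t)))"
    by (intro Bochner_Integration.integral_cong) (auto simp: field_simps)
  also have "\<dots> = (LINT t:{0..2 * pi}|lborel. \<phi> (cis t)) /\<^sub>R (2 * pi)"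
    by (simp only: set_lebesgue_integral_def integral_scaleR_right)
  also have "(LINT t:{0..2 * pi}|lborel. \<phi> (cis t)) = integral {0..2 * pi} (\<lambda>t. \<phi> (cis t))"
    using borel_integrable_atLeastAtMost'[OF \<phi>c] by (intro set_borel_integral_eq_integral)
  finally show ?thesis .
qed

lemma circle_mean_holomorphic:
  assumes F: "F holomorphic_on cball 0 1"
  shows "(LINT \<zeta>|arc_measure. F \<zeta>) = F 0"
proof -
  have cont: "continuous_on (sphere 0 1) F"
    using F by (intro holomorphic_on_imp_continuous_on holomorphic_on_subset[OF F]) auto
  have "((\<lambda>u. F u / (u - 0)) has_contour_integral (2 * of_real pi * \<i> * F 0)) (circlepath 0 1)"
    using F by (intro Cauchy_integral_circlepath_simple) auto
  then have "((\<lambda>t. \<i> * F (cis t)) has_integral (2 * of_real pi * \<i> * F 0)) {0..2 * pi}"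
    unfolding circlepath_def by (simp add: has_contour_integral_part_circlepath_iff mult_ac)
  then have "((\<lambda>t. (- \<i>) * (\<i> * F (cis t))) has_integral (- \<i>) * (2 * of_real pi * \<i> * F 0)) {0..2 * pi}"
    by (rule has_integral_mult_right)
  then have "integral {0..2 * pi} (\<lambda>t. F (cis t)) = 2 * of_real pi * F 0"
    by (intro integral_unique) (simp add: mult_ac)
  then show ?thesis unfolding integral_arc_measure[OF cont] by (simp add: scaleR_conv_of_real)
qed

lemma circle_mean_Re_holomorphic:
  assumes F: "F holomorphic_on cball 0 1"
  shows "(LINT \<zeta>|arc_measure. Re (F \<zeta>)) = Re (F 0)"
proof -
  have "continuous_on (sphere 0 1) F"
    using F by (intro holomorphic_on_imp_continuous_on holomorphic_on_subset[OF F]) auto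
  then have "integrable arc_measure F" by (rule integrable_arc_measure)
  then show ?thesis using circle_mean_holomorphic[OF F] by (simp add: integral_Re)
qed

lemma circle_integral_mono:
  fixes \<phi> \<psi> :: "complex \<Rightarrow> real"
  assumes "continuous_on (sphere 0 1) \<phi>" "continuous_on (sphere 0 1) \<psi>"
    and "\<And>z. norm z = 1 \<Longrightarrow> \<phi> z \<le> \<psi> z"
  shows "(LINT \<zeta>|arc_measure. \<phi> \<zeta>) \<le> (LINT \<zeta>|arc_measure. \<psi> \<zeta>)"
  using assms
  by (intro integral_mono integrable_arc_measure) (auto simp: arc_measure_def space_restrict_space)

lemma circle_integral_const [simp]: "(LINT \<zeta>|arc_measure. (c::real)) = c"
proof -
  interpret prob_space arc_measure by (rule prob_space_arc_measure)
  show ?thesis using prob_space by simp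
qed

text \<open>On the circle these are exactly the real trigonometric polynomials, since there negative powers of \<open>z\<close> are
  conjugates of positive ones. Each of them comes with a harmonic extension to the disc.\<close>

definition circle_Re_poly :: "(complex \<Rightarrow> real) set" where
  "circle_Re_poly = {\<phi>. \<exists>p. \<forall>z\<in>sphere 0 1. \<phi> z = Re (poly p z)}"

lemma circle_Re_poly_add:
  assumes "\<phi> \<in> circle_Re_poly" "\<psi> \<in> circle_Re_poly"
  shows "(\<lambda>z. \<phi> z + \<psi> z) \<in> circle_Re_poly"
proof -
  from assms obtain p r where "\<And>z. z \<in> sphere 0 1 \<Longrightarrow> \<phi> z = Re (poly p z)"
    "\<And>z. z \<in> sphere 0 1 \<Longrightarrow> \<psi> z = Re (poly r z)" unfolding circle_Re_poly_def by blast
  then show ?thesis unfolding circle_Re_poly_def by (auto intro!: exI[of _ "p + r"])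
qed

lemma circle_Re_poly_sum:
  assumes "\<And>i. i \<in> I \<Longrightarrow> \<phi> i \<in> circle_Re_poly"
  shows "(\<lambda>z. \<Sum>i\<in>I. \<phi> i z) \<in> circle_Re_poly"
  using assms
proof (induction I rule: infinite_finite_induct)
  case (insert x I)
  then show ?case using circle_Re_poly_add[of "\<phi> x" "\<lambda>z. \<Sum>i\<in>I. \<phi> i z"] by simp
qed (auto simp: circle_Re_poly_def intro!: exI[of _ 0])

lemma circle_Re_poly_monom: "(\<lambda>z. Re (a * z ^ k)) \<in> circle_Re_poly"
  unfolding circle_Re_poly_def by (auto intro!: exI[of _ "monom a k"] simp: poly_monom)

text \<open>\<open>Re u * Re v = Re (u * v + u * cnj v) / 2\<close>, and on the circle \<open>z ^ i * cnj z ^ j\<close> is a power of \<open>z\<close>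
  or of \<open>cnj z\<close>.\<close>

lemma circle_Re_poly_monom_mult:
  "\<exists>\<phi>\<in>circle_Re_poly. \<forall>z\<in>sphere 0 1. \<phi> z = Re (a * z ^ i) * Re (b * z ^ j)"
proof -
  define m where "m = (\<lambda>z. if j \<le> i then Re (a * cnj b / 2 * z ^ (i - j)) else Re (cnj a * b / 2 * z ^ (j - i)))"
  have m: "m \<in> circle_Re_poly"
    unfolding m_def by (cases "j \<le> i") (simp_all only: if_True if_False circle_Re_poly_monom)
  have Re2: "Re u * Re v = Re (u * v / 2) + Re (u * cnj v / 2)" for u v by (simp add: field_simps)
  show ?thesis
  proof (intro bexI ballI)
    show "(\<lambda>z. Re (a * b / 2 * z ^ (i + j)) + m z) \<in> circle_Re_poly"
      by (intro circle_Re_poly_add m circle_Re_poly_monom)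
    fix z :: complex assume "z \<in> sphere 0 1"
    then have zz: "z * cnj z = 1" by (simp add: complex_norm_square[symmetric])
    have "Re (a * z ^ i * cnj (b * z ^ j) / 2) = m z"
    proof (cases "j \<le> i")
      case True
      have "z ^ i * cnj z ^ j = z ^ (i - j) * (z * cnj z) ^ j"
        using True by (simp add: power_mult_distrib power_add[symmetric] mult.assoc[symmetric])
      then have e: "z ^ i * cnj z ^ j = z ^ (i - j)" using zz by simp
      have "a * z ^ i * cnj (b * z ^ j) / 2 = a * cnj b / 2 * (z ^ i * cnj z ^ j)" by simp
      then show ?thesis using True unfolding e by (simp only: m_def if_True)
    next
      case False
      have "z ^ i * cnj z ^ j = cnj z ^ (j - i) * (z * cnj z) ^ i"
        using False by (simp add: power_mult_distrib power_add[symmetric] mult.assoc[symmetric] mult.commute[of "z ^ i"])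
      then have e: "z ^ i * cnj z ^ j = cnj z ^ (j - i)" using zz by simp
      have "a * z ^ i * cnj (b * z ^ j) / 2 = a * cnj b / 2 * (z ^ i * cnj z ^ j)" by simp
      also have "\<dots> = cnj (cnj a * b / 2 * z ^ (j - i))" unfolding e by simp
      finally show ?thesis using False by (simp only: m_def if_False cnj.simps)
    qed
    then show "Re (a * b / 2 * z ^ (i + j)) + m z = Re (a * z ^ i) * Re (b * z ^ j)"
      unfolding Re2 by (simp add: power_add mult_ac)
  qed
qed

lemma circle_Re_poly_cong:
  "\<phi> \<in> circle_Re_poly \<Longrightarrow> (\<And>z. z \<in> sphere 0 1 \<Longrightarrow> \<phi> z = \<psi> z) \<Longrightarrow> \<psi> \<in> circle_Re_poly"
  unfolding circle_Re_poly_def by fastforce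

lemma circle_Re_poly_mult:
  assumes "\<phi> \<in> circle_Re_poly" "\<psi> \<in> circle_Re_poly"
  shows "(\<lambda>z. \<phi> z * \<psi> z) \<in> circle_Re_poly"
proof -
  from assms obtain p r where p: "\<And>z. z \<in> sphere 0 1 \<Longrightarrow> \<phi> z = Re (poly p z)"
    and r: "\<And>z. z \<in> sphere 0 1 \<Longrightarrow> \<psi> z = Re (poly r z)" unfolding circle_Re_poly_def by blast
  obtain \<omega> where \<omega>: "\<And>i j. \<omega> i j \<in> circle_Re_poly"
      "\<And>i j z. z \<in> sphere 0 1 \<Longrightarrow> \<omega> i j z = Re (coeff p i * z ^ i) * Re (coeff r j * z ^ j)"
  proof -
    have "\<forall>i j. \<exists>\<omega>. \<omega> \<in> circle_Re_poly \<and>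
        (\<forall>z\<in>sphere 0 1. \<omega> z = Re (coeff p i * z ^ i) * Re (coeff r j * z ^ j))"
      using circle_Re_poly_monom_mult by blast
    then show ?thesis using that by metis
  qed
  have "(\<lambda>z. \<Sum>i\<le>degree p. \<Sum>j\<le>degree r. \<omega> i j z) \<in> circle_Re_poly"
    by (intro circle_Re_poly_sum \<omega>)
  then show ?thesis
  proof (rule circle_Re_poly_cong)
    fix z :: complex assume z: "z \<in> sphere 0 1"
    show "(\<Sum>i\<le>degree p. \<Sum>j\<le>degree r. \<omega> i j z) = \<phi> z * \<psi> z"
      unfolding p[OF z] r[OF z] poly_altdef Re_sum sum_product by (simp only: \<omega>(2)[OF z])
  qed
qed

text \<open>An approximate solution of the Dirichlet problem: by Stone--Weierstrass, every continuous function on the circle is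
  uniformly close to the boundary values of an explicit harmonic function.\<close>

lemma circle_Re_poly_dense:
  fixes u :: "complex \<Rightarrow> real"
  assumes u: "continuous_on (sphere 0 1) u" and e: "0 < e"
  obtains p where "\<And>z. norm z = 1 \<Longrightarrow> \<bar>u z - Re (poly p z)\<bar> < e"
proof -
  interpret function_ring_on circle_Re_poly "sphere 0 1"
  proof
    show "compact (sphere (0::complex) 1)" by simp
    fix \<phi> \<psi> assume \<phi>: "\<phi> \<in> circle_Re_poly"
    then obtain p where "\<And>z. z \<in> sphere 0 1 \<Longrightarrow> \<phi> z = Re (poly p z)" unfolding circle_Re_poly_def by blast
    then show "continuous_on (sphere 0 1) \<phi>"
      by (subst continuous_on_cong[OF refl]) (auto intro!: continuous_intros)
    assume \<psi>: "\<psi> \<in> circle_Re_poly"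
    show "(\<lambda>x. \<phi> x + \<psi> x) \<in> circle_Re_poly" "(\<lambda>x. \<phi> x * \<psi> x) \<in> circle_Re_poly"
      using \<phi> \<psi> by (simp_all add: circle_Re_poly_add circle_Re_poly_mult)
  next
    fix c :: real
    show "(\<lambda>_. c) \<in> circle_Re_poly" using circle_Re_poly_monom[of "of_real c" 0] by simp
  next
    fix x y :: complex assume "x \<noteq> y"
    then have "Re (1 * x ^ 1) \<noteq> Re (1 * y ^ 1) \<or> Re (- \<i> * x ^ 1) \<noteq> Re (- \<i> * y ^ 1)" by (auto simp: complex_eq_iff)
    then show "\<exists>f\<in>circle_Re_poly. f x \<noteq> f y"
      using circle_Re_poly_monom[of 1 1] circle_Re_poly_monom[of "- \<i>" 1] by (elim disjE) (rule bexI, assumption+)+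
  qed
  obtain \<phi> where "\<phi> \<in> circle_Re_poly" "\<forall>x\<in>sphere 0 1. \<bar>u x - \<phi> x\<bar> < e"
    using Stone_Weierstrass_basic[OF u e] by auto
  then show ?thesis using that unfolding circle_Re_poly_def by fastforce
qed

section \<open>A superharmonic power and its circle means\<close>

text \<open>The absolute value of the argument, unlike the argument itself, is continuous across the negative axis.\<close>

lemma abs_Arg_eq_arccos: "\<zeta> \<noteq> 0 \<Longrightarrow> \<bar>Arg \<zeta>\<bar> = arccos (Re \<zeta> / norm \<zeta>)"
  using abs_Arg_le_pi[of \<zeta>] arccos_cos[of "\<bar>Arg \<zeta>\<bar>"] by (subst Re_eq_norm_cos_abs_Arg) simp

lemma abs_Re_div_norm_le_1: "\<bar>Re \<zeta> / norm \<zeta>\<bar> \<le> 1"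
  by (simp add: abs_Re_le_cmod divide_le_eq_1)

lemma continuous_on_abs_Arg: "continuous_on (- {0}) (\<lambda>\<zeta>. \<bar>Arg \<zeta>\<bar>)"
proof -
  have "continuous_on (- {0}) (\<lambda>\<zeta>. arccos (Re \<zeta> / norm \<zeta>))"
  proof (intro continuous_intros)
    show "\<forall>\<zeta>\<in>- {0}. - 1 \<le> Re \<zeta> / norm \<zeta> \<and> Re \<zeta> / norm \<zeta> \<le> 1"
      using abs_Re_div_norm_le_1 unfolding abs_le_iff by (meson minus_le_iff)
  qed auto
  then show ?thesis by (subst continuous_on_cong[OF refl abs_Arg_eq_arccos]) auto
qed

lemma abs_Arg_inverse: "\<bar>Arg (inverse \<zeta>)\<bar> = \<bar>Arg \<zeta>\<bar>"
  by (simp add: Arg_inverse)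

lemma abs_Arg_mult_le: "\<bar>Arg (z * w)\<bar> \<le> \<bar>Arg z\<bar> + \<bar>Arg w\<bar>"
proof (cases "z = 0 \<or> w = 0 \<or> pi \<le> \<bar>Arg z\<bar> + \<bar>Arg w\<bar>")
  case True
  then show ?thesis using abs_Arg_le_pi[of "z * w"] by (auto simp: Arg_zero)
next
  case False
  then have "Arg (z * w) = Arg z + Arg w" by (intro Arg_times) auto
  then show ?thesis by simp
qed

lemma continuous_superharmonic_power:
  assumes q: "0 < q"
  shows "continuous_on S (superharmonic_power q)"
proof -
  have "isCont (superharmonic_power q) \<zeta>" for \<zeta>
  proof (cases "\<zeta> = 0")
    case True
    have "((\<lambda>\<zeta>::complex. norm \<zeta> powr q) \<longlongrightarrow> norm (0::complex) powr q) (at 0)"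
      using q by (intro tendsto_powr' tendsto_intros) auto
    then have "(superharmonic_power q \<longlongrightarrow> 0) (at 0)"
      using q by (intro Lim_null_comparison[where g = "\<lambda>\<zeta>. norm \<zeta> powr q" and f = "superharmonic_power q"])
        (auto simp: superharmonic_power_def abs_mult mult_left_le intro!: always_eventually)
    then show ?thesis using True q by (simp add: isCont_def superharmonic_power_def)
  next
    case False
    have "continuous_on (- {0}) (superharmonic_power q)"
      unfolding superharmonic_power_def
      by (intro continuous_on_mult continuous_on_powr' continuous_on_cos continuous_on_min
          continuous_on_mult_left[OF continuous_on_abs_Arg] continuous_on_norm continuous_on_id
          continuous_on_const) auto
    moreover have "open (- {0::complex})" by (simp add: open_Compl)
    ultimately show ?thesis using False continuous_on_eq_continuous_at by blast
  qed
  then show ?thesis by (simp add: continuous_at_imp_continuous_on)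
qed

lemma open_sector: "open {\<zeta>. \<zeta> \<noteq> 0 \<and> q * \<bar>Arg \<zeta>\<bar> < pi}"
proof -
  have "open (- {0} \<inter> (\<lambda>\<zeta>. q * \<bar>Arg \<zeta>\<bar>) -` {..<pi})"
    by (intro continuous_open_preimage continuous_on_mult_left[OF continuous_on_abs_Arg]) auto
  moreover have "- {0} \<inter> (\<lambda>\<zeta>. q * \<bar>Arg \<zeta>\<bar>) -` {..<pi} = {\<zeta>. \<zeta> \<noteq> 0 \<and> q * \<bar>Arg \<zeta>\<bar> < pi}" by auto
  ultimately show ?thesis by simp
qed

lemma Re_exp_Ln:
  assumes "\<zeta> \<noteq> 0"
  shows "Re (exp (of_real q * Ln \<zeta>)) = norm \<zeta> powr q * cos (q * \<bar>Arg \<zeta>\<bar>)"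
  using assms by (simp add: Re_exp Arg_eq_Im_Ln powr_def abs_if)

lemma sector_not_nonpos_Reals:
  assumes "1 \<le> q" "\<zeta> \<noteq> 0" "q * \<bar>Arg \<zeta>\<bar> < pi" shows "\<zeta> \<notin> \<real>\<^sub>\<le>\<^sub>0"
proof
  assume "\<zeta> \<in> \<real>\<^sub>\<le>\<^sub>0"
  then have "Arg \<zeta> = pi" using assms(2) by (auto simp: complex_nonpos_Reals_iff Arg_eq_pi complex_eq_iff)
  then show False using assms mult_right_mono[of 1 q pi] by simp
qed

text \<open>Superharmonicity away from \<open>0\<close>: near each point the function lies below the real part of a holomorphic function
  that touches it there. Inside the sector this is the principal branch of the power. At \<open>\<zeta>0\<close> outside it, the
  power is turned so that it is real and negative at \<open>\<zeta>0\<close>; turning \<open>\<zeta>0\<close> by an angle \<open>\<delta>\<close> lowers \<open>\<bar>Arg\<bar>\<close> by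
  at most \<open>\<delta>\<close>, so the angular factor cannot exceed \<open>- cos (q * \<delta>)\<close>.\<close>

lemma superharmonic_power_local_majorant:
  assumes q: "1 \<le> q" and \<zeta>0: "\<zeta>0 \<noteq> 0"
  obtains N G where "open N" "\<zeta>0 \<in> N" "G holomorphic_on N"
    "\<And>\<zeta>. \<zeta> \<in> N \<Longrightarrow> superharmonic_power q \<zeta> \<le> Re (G \<zeta>)" "superharmonic_power q \<zeta>0 = Re (G \<zeta>0)"
proof (cases "q * \<bar>Arg \<zeta>0\<bar> < pi")
  case True
  let ?N = "{\<zeta>. \<zeta> \<noteq> 0 \<and> q * \<bar>Arg \<zeta>\<bar> < pi}"
  have eq: "superharmonic_power q \<zeta> = Re (exp (of_real q * Ln \<zeta>))" if "\<zeta> \<in> ?N" for \<zeta>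
    using that by (simp add: Re_exp_Ln superharmonic_power_def min_def)
  show ?thesis
  proof (rule that[of ?N "\<lambda>\<zeta>. exp (of_real q * Ln \<zeta>)"])
    show "(\<lambda>\<zeta>. exp (of_real q * Ln \<zeta>)) holomorphic_on ?N"
      using q by (intro holomorphic_intros) (auto dest: sector_not_nonpos_Reals)
  qed (use True \<zeta>0 eq open_sector in auto)
next
  case False
  let ?S = "{\<zeta>. \<zeta> \<noteq> 0 \<and> q * \<bar>Arg \<zeta>\<bar> < pi}"
  let ?N = "(\<lambda>\<zeta>. \<zeta> / \<zeta>0) -` ?S"
  define G where "G = (\<lambda>\<zeta>. - of_real (norm \<zeta>0 powr q) * exp (of_real q * Ln (\<zeta> / \<zeta>0)))"
  have G: "Re (G \<zeta>) = - (norm \<zeta> powr q * cos (q * \<bar>Arg (\<zeta> / \<zeta>0)\<bar>))" if "\<zeta> \<noteq> 0" for \<zeta>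
    using that \<zeta>0 unfolding G_def
    by (simp add: Re_exp_Ln norm_divide powr_divide)
  show ?thesis
  proof (rule that[of ?N G])
    show "open ?N" using \<zeta>0 by (intro open_vimage open_sector continuous_intros) auto
    show "\<zeta>0 \<in> ?N" using \<zeta>0 by simp
    show "G holomorphic_on ?N"
      unfolding G_def using q \<zeta>0
      by (intro holomorphic_intros) (auto dest!: sector_not_nonpos_Reals[rotated 2])
    show "superharmonic_power q \<zeta>0 = Re (G \<zeta>0)"
      using False \<zeta>0 by (simp add: G superharmonic_power_def min_def)
    fix \<zeta> assume "\<zeta> \<in> ?N"
    then have \<zeta>: "\<zeta> \<noteq> 0" "q * \<bar>Arg (\<zeta> / \<zeta>0)\<bar> < pi" by auto
    define \<delta> where "\<delta> = \<bar>Arg (\<zeta> / \<zeta>0)\<bar>"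
    have "\<bar>Arg \<zeta>0\<bar> = \<bar>Arg (\<zeta> * inverse (\<zeta> / \<zeta>0))\<bar>" using \<zeta> \<zeta>0 by simp
    also have "\<dots> \<le> \<bar>Arg \<zeta>\<bar> + \<delta>" unfolding \<delta>_def using abs_Arg_mult_le abs_Arg_inverse by metis
    finally have "q * \<bar>Arg \<zeta>0\<bar> \<le> q * (\<bar>Arg \<zeta>\<bar> + \<delta>)" using q by (intro mult_left_mono) auto
    then have "pi - q * \<delta> \<le> q * \<bar>Arg \<zeta>\<bar>" using False by (simp add: distrib_left)
    moreover have "0 \<le> q * \<delta>" using q by (simp add: \<delta>_def)
    ultimately have "cos (min (q * \<bar>Arg \<zeta>\<bar>) pi) \<le> cos (pi - q * \<delta>)"
      using \<zeta>(2) by (intro cos_monotone_0_pi_le) (auto simp: \<delta>_def)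
    then have "norm \<zeta> powr q * cos (min (q * \<bar>Arg \<zeta>\<bar>) pi) \<le> norm \<zeta> powr q * (- cos (q * \<delta>))"
      by (intro mult_left_mono) auto
    then show "superharmonic_power q \<zeta> \<le> Re (G \<zeta>)"
      unfolding G[OF \<zeta>(1)] superharmonic_power_def \<delta>_def by simp
  qed
qed

text \<open>If the harmonic function \<open>Re p\<close> lies below \<open>V \<circ> F\<close>, with \<open>V = superharmonic_power q\<close>, on the circle, then it
  does so at the centre. At the zeros of \<open>F\<close> no local majorant is available; they are excluded from the minimum by the
  barrier \<open>- \<epsilon> * ln (norm F)\<close>, which tends to infinity there.\<close>

lemma superharmonic_power_minimum_principle:
  assumes q: "1 \<le> q" and R: "1 < R" and F: "F holomorphic_on ball 0 R" and F0: "F 0 = 0"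
    and le: "\<And>z. norm z = 1 \<Longrightarrow> Re (poly p z) \<le> superharmonic_power q (F z)"
  shows "Re (poly p 0) \<le> 0"
proof (rule ccontr)
  assume "\<not> Re (poly p 0) \<le> 0"
  then have P0: "0 < Re (poly p 0)" by simp
  define u where "u = (\<lambda>z. superharmonic_power q (F z))"
  have cbR: "cball 0 1 \<subseteq> ball (0::complex) R" using R by (auto simp: subset_eq)
  have Fc: "continuous_on (cball 0 1) F"
    using F cbR by (intro holomorphic_on_imp_continuous_on holomorphic_on_subset[OF F])
  have uc: "continuous_on (cball 0 1) u"
    unfolding u_def using q
    by (intro continuous_on_compose2[OF continuous_superharmonic_power[of q UNIV] Fc]) auto
  define v where "v = (\<lambda>z. u z - Re (poly p z))"
  have vc: "continuous_on (cball 0 1) v"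
    unfolding v_def by (intro continuous_intros uc)
  have v0: "v 0 < 0" using P0 F0 by (simp add: v_def u_def superharmonic_power_def)
  have vT: "0 \<le> v z" if "norm z = 1" for z using le[OF that] by (simp add: v_def u_def)
  have "\<exists>z. norm z < 1 \<and> v z < 0 \<and> F z \<noteq> 0"
  proof (rule ccontr)
    assume contra: "\<not> ?thesis"
    have "continuous_on (ball 0 1) v" using vc by (rule continuous_on_subset) auto
    then have "open (ball 0 1 \<inter> v -` {..<0})" by (intro continuous_open_preimage) auto
    moreover have "0 \<in> ball 0 1 \<inter> v -` {..<0}" using v0 by simp
    moreover have "F z = 0" if "z \<in> ball 0 1 \<inter> v -` {..<0}" for z using contra that by force
    ultimately have F0: "F z = 0" if "z \<in> ball 0 R" for z
      using analytic_continuation_open[of "ball 0 1 \<inter> v -` {..<0}" "ball 0 R" F "\<lambda>_. 0" z] F that cbR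
      by (force simp: holomorphic_on_const)
    have "Re (poly p 0) = (LINT \<zeta>|arc_measure. Re (poly p \<zeta>))"
      by (intro circle_mean_Re_holomorphic[symmetric] holomorphic_intros)
    also have "\<dots> \<le> (LINT \<zeta>|arc_measure. 0)"
    proof (rule circle_integral_mono)
      fix z :: complex assume z: "norm z = 1"
      then have "F z = 0" using F0[of z] R by simp
      then show "Re (poly p z) \<le> 0" using le[OF z] by (simp add: superharmonic_power_def)
    qed (intro continuous_intros)+
    finally show False using P0 by simp
  qed
  then obtain z1 where z1: "norm z1 < 1" "v z1 < 0" "F z1 \<noteq> 0" by blast
  obtain M where M: "0 < M" "\<And>z. z \<in> cball 0 1 \<Longrightarrow> norm (F z) \<le> M"
  proof -
    have "bounded (F ` cball 0 1)" by (intro compact_imp_bounded compact_continuous_image Fc) auto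
    then show ?thesis using that unfolding bounded_pos by auto
  qed
  obtain C where C: "\<And>z. z \<in> cball 0 1 \<Longrightarrow> \<bar>v z\<bar> \<le> C"
  proof -
    have "bounded (v ` cball 0 1)" by (intro compact_imp_bounded compact_continuous_image vc) auto
    then obtain C where "\<forall>y\<in>v ` cball 0 1. norm y \<le> C" unfolding bounded_iff by blast
    then show ?thesis by (intro that[of C]) force
  qed
  define \<eta> where "\<eta> = - v z1 / 4"
  define L where "L = ln (M / norm (F z1))"
  define \<epsilon> where "\<epsilon> = - v z1 / (4 * (L + 1))"
  have L0: "0 \<le> L" unfolding L_def using M(2)[of z1] z1 by simp
  have \<eta>: "0 < \<eta>" using z1 by (simp add: \<eta>_def)
  have \<epsilon>: "0 < \<epsilon>" unfolding \<epsilon>_def using z1 L0 by (intro divide_pos_pos) auto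
  \<comment> \<open>The term with \<open>\<eta>\<close> makes the function strictly superharmonic, so that it cannot have an interior minimum. The sizes
    of \<open>\<epsilon>\<close> and \<open>\<eta>\<close> are such that \<open>w\<close> is still negative at \<open>z1\<close>.\<close>
  define w where "w = (\<lambda>z. v z - \<epsilon> * ln (norm (F z) / M) + \<eta> * (1 - norm z ^ 2))"
  have wz1: "w z1 < 0"
  proof -
    have "\<epsilon> * L \<le> \<epsilon> * (L + 1)" using \<epsilon> by simp
    also have "\<epsilon> * (L + 1) = - v z1 / 4" using L0 by (simp add: \<epsilon>_def field_simps)
    finally have "\<epsilon> * L \<le> - v z1 / 4" .
    moreover have lnL: "ln (norm (F z1) / M) = - L" unfolding L_def using z1 M by (simp add: ln_div)
    moreover have "\<eta> * (1 - norm z1 ^ 2) \<le> \<eta> * 1" using \<eta> by (intro mult_left_mono) auto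
    moreover have "\<eta> * 1 = - v z1 / 4" by (simp add: \<eta>_def)
    ultimately show ?thesis using z1(2) unfolding w_def lnL mult_minus_right by linarith
  qed
  define \<delta> where "\<delta> = M * exp (- C / \<epsilon>)"
  have \<delta>: "0 < \<delta>" using M by (simp add: \<delta>_def)
  have wlarge: "0 \<le> w z" if z: "norm z \<le> 1" "F z \<noteq> 0" "norm (F z) < \<delta>" for z
  proof -
    have "ln (norm (F z) / M) \<le> ln (\<delta> / M)" using z M \<delta> by (simp add: ln_mono divide_right_mono)
    also have "\<dots> = - C / \<epsilon>" using M by (simp add: \<delta>_def)
    finally have "\<epsilon> * ln (norm (F z) / M) \<le> \<epsilon> * (- C / \<epsilon>)" using \<epsilon> by (intro mult_left_mono) auto
    moreover have "0 \<le> \<eta> * (1 - norm z ^ 2)" using \<eta> z by (simp add: power_le_one)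
    moreover have "- C \<le> v z" using C[of z] z by (simp add: abs_le_iff)
    ultimately show ?thesis using \<epsilon> by (simp add: w_def)
  qed
  define K where "K = cball 0 1 \<inter> (\<lambda>z. norm (F z)) -` {\<delta>..}"
  have "closed K" unfolding K_def by (intro continuous_closed_preimage continuous_intros Fc) auto
  moreover have "bounded K" unfolding K_def by (rule bounded_subset[of "cball 0 1"]) auto
  ultimately have "compact K" by (simp add: compact_eq_bounded_closed)
  moreover have "z1 \<in> K" using wlarge[of z1] wz1 z1 by (fastforce simp: K_def)
  moreover have "continuous_on K w"
  proof -
    have "K \<subseteq> cball 0 1" by (auto simp: K_def)
    moreover have "norm (F z) / M \<noteq> 0" if "z \<in> K" for z using that \<delta> M by (auto simp: K_def)
    ultimately show ?thesis unfolding w_def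
      by (intro continuous_intros continuous_on_subset[OF vc] continuous_on_subset[OF Fc]) (use M in auto)
  qed
  ultimately obtain z0 where z0: "z0 \<in> K" "\<And>z. z \<in> K \<Longrightarrow> w z0 \<le> w z"
    using continuous_attains_inf[of K w] by blast
  have wz0: "w z0 < 0" using z0(2)[OF \<open>z1 \<in> K\<close>] wz1 by simp
  have Fz0: "F z0 \<noteq> 0" "norm z0 \<le> 1" using z0(1) \<delta> by (auto simp: K_def)
  have z0in: "norm z0 < 1"
  proof (rule ccontr)
    assume "\<not> norm z0 < 1"
    then have z: "norm z0 = 1" using Fz0 by simp
    have "ln (norm (F z0) / M) \<le> 0" using M Fz0 by (simp add: ln_le_zero_iff)
    then have "\<epsilon> * ln (norm (F z0) / M) \<le> 0" using \<epsilon> by (intro mult_nonneg_nonpos) auto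
    then have "0 \<le> w z0" using vT[OF z] z by (simp add: w_def)
    then show False using wz0 by simp
  qed
  obtain N G where N: "open N" "F z0 \<in> N" "G holomorphic_on N"
    "\<And>\<zeta>. \<zeta> \<in> N \<Longrightarrow> superharmonic_power q \<zeta> \<le> Re (G \<zeta>)" "superharmonic_power q (F z0) = Re (G (F z0))"
    using superharmonic_power_local_majorant[OF q Fz0(1)] by blast
  define N' where "N' = N \<inter> (\<lambda>\<zeta>. \<zeta> / F z0) -` (- \<real>\<^sub>\<le>\<^sub>0)"
  have oN': "open N'" unfolding N'_def using N Fz0
    by (intro open_Int open_vimage continuous_intros) (auto simp: closed_nonpos_Reals_complex open_Compl)
  define D where "D = ball 0 1 \<inter> F -` N'"
  have oD: "open D" unfolding D_def
    by (intro continuous_open_preimage oN' continuous_on_subset[OF Fc]) auto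
  have z0D: "z0 \<in> D" using z0in N Fz0 by (simp add: D_def N'_def)
  have wD: "w z0 \<le> w z" if z: "z \<in> D" for z
  proof (cases "z \<in> K")
    case False
    have "F z \<noteq> 0" using z by (auto simp: D_def N'_def)
    then show ?thesis using wlarge[of z] wz0 z False by (auto simp: D_def K_def)
  qed (use z0 in auto)
  \<comment> \<open>The holomorphic function whose real part touches \<open>w\<close>, up to the \<open>\<eta>\<close>-term, from above at the minimum \<open>z0\<close>.\<close>
  define H where "H = (\<lambda>z. G (F z) - poly p z - of_real \<epsilon> * (Ln (F z / F z0) + of_real (ln (norm (F z0) / M))))"
  have HD: "H holomorphic_on D"
  proof -
    have FD: "F holomorphic_on D" using cbR by (intro holomorphic_on_subset[OF F]) (auto simp: D_def)
    have "(G \<circ> F) holomorphic_on D"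
      by (rule holomorphic_on_compose_gen[OF FD N(3)]) (auto simp: D_def N'_def)
    moreover have "F z / F z0 \<notin> \<real>\<^sub>\<le>\<^sub>0" if "z \<in> D" for z using that by (auto simp: D_def N'_def)
    ultimately show ?thesis unfolding H_def comp_def using Fz0
      by (intro holomorphic_intros FD) auto
  qed
  have ReLn: "Re (Ln (F z / F z0) + of_real (ln (norm (F z0) / M))) = ln (norm (F z) / M)" if "z \<in> D" for z
  proof -
    have "F z \<noteq> 0" using that by (auto simp: D_def N'_def)
    then show ?thesis using Fz0 M by (simp add: norm_divide ln_div)
  qed
  have wH: "w z \<le> Re (H z) + \<eta> * (1 - norm z ^ 2)" if z: "z \<in> D" for z
    using N(4)[of "F z"] ReLn[OF z] z by (simp add: w_def H_def v_def u_def D_def N'_def)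
  have wH0: "w z0 = Re (H z0) + \<eta> * (1 - norm z0 ^ 2)"
    using N(5) ReLn[OF z0D] by (simp add: w_def H_def v_def u_def)
  obtain r where r: "0 < r" "cball z0 r \<subseteq> D" using oD z0D by (meson open_contains_cball)
  \<comment> \<open>On the circle of radius \<open>r\<close> about \<open>z0\<close> the \<open>\<eta>\<close>-term is a constant plus a linear function, which is absorbed
    into the holomorphic function; its mean then contradicts the minimum.\<close>
  define H2 where "H2 = (\<lambda>\<zeta>. H (z0 + of_real r * \<zeta>) - of_real (2 * \<eta> * r) * cnj z0 * \<zeta>)"
  have in_D: "z0 + of_real r * \<zeta> \<in> D" if "norm \<zeta> \<le> 1" for \<zeta>
    using that r by (intro subsetD[OF r(2)]) (auto simp: dist_norm norm_mult mult_left_le)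
  have H2h: "H2 holomorphic_on cball 0 1"
  proof -
    have "(H \<circ> (\<lambda>\<zeta>. z0 + of_real r * \<zeta>)) holomorphic_on cball 0 1"
      by (rule holomorphic_on_compose_gen[OF _ HD]) (use in_D in \<open>auto intro!: holomorphic_intros\<close>)
    then show ?thesis unfolding H2_def comp_def by (intro holomorphic_intros)
  qed
  have "Re (H z0) + \<eta> * r ^ 2 = (LINT \<zeta>|arc_measure. Re (H z0) + \<eta> * r ^ 2)"
    by (rule circle_integral_const[symmetric])
  also have "\<dots> \<le> (LINT \<zeta>|arc_measure. Re (H2 \<zeta>))"
  proof (rule circle_integral_mono)
    show "continuous_on (sphere 0 1) (\<lambda>\<zeta>. Re (H2 \<zeta>))"
      by (intro continuous_intros holomorphic_on_imp_continuous_on holomorphic_on_subset[OF H2h]) auto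
    fix \<zeta> :: complex assume \<zeta>: "norm \<zeta> = 1"
    have "norm (z0 + of_real r * \<zeta>) ^ 2 = norm z0 ^ 2 + r ^ 2 * norm \<zeta> ^ 2 + 2 * r * Re (cnj z0 * \<zeta>)"
      unfolding cmod_power2 by (simp add: power2_eq_square algebra_simps)
    moreover have "w z0 \<le> Re (H (z0 + of_real r * \<zeta>)) + \<eta> * (1 - norm (z0 + of_real r * \<zeta>) ^ 2)"
      using order_trans[OF wD wH] in_D[of \<zeta>] \<zeta> by simp
    ultimately show "Re (H z0) + \<eta> * r ^ 2 \<le> Re (H2 \<zeta>)"
      unfolding wH0 H2_def using \<zeta> by (simp add: algebra_simps)
  qed (intro continuous_intros)
  also have "\<dots> = Re (H2 0)" by (rule circle_mean_Re_holomorphic[OF H2h])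
  also have "\<dots> = Re (H z0)" by (simp add: H2_def)
  finally have "\<eta> * r ^ 2 \<le> 0" by simp
  moreover have "0 < \<eta> * r ^ 2" using \<eta> r by simp
  ultimately show False by simp
qed

text \<open>Approximating \<open>V \<circ> F\<close> on the circle from below by the real part of a polynomial \<open>p\<close>, the mean of \<open>V \<circ> F\<close> is
  close to \<open>Re (p 0)\<close>, which the minimum principle bounds by \<open>V (F 0) = 0\<close>.\<close>

lemma circle_mean_superharmonic_power_le_0:
  assumes q: "1 \<le> q" and R: "1 < R" and F: "F holomorphic_on ball 0 R" and F0: "F 0 = 0"
  shows "(LINT \<zeta>|arc_measure. superharmonic_power q (F \<zeta>)) \<le> 0"
proof (rule field_le_epsilon)
  fix e :: real assume e: "0 < e"
  define u where "u = (\<lambda>z. superharmonic_power q (F z))"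
  have "sphere 0 1 \<subseteq> ball (0::complex) R" using R by (auto simp: subset_eq)
  then have "continuous_on (sphere 0 1) F"
    by (intro holomorphic_on_imp_continuous_on holomorphic_on_subset[OF F])
  then have uc: "continuous_on (sphere 0 1) u"
    unfolding u_def using q
    by (intro continuous_on_compose2[OF continuous_superharmonic_power[of q UNIV]]) auto
  obtain p where p: "\<And>z. norm z = 1 \<Longrightarrow> \<bar>(u z - e / 2) - Re (poly p z)\<bar> < e / 2"
    by (rule circle_Re_poly_dense[of "\<lambda>z. u z - e / 2" "e / 2"]) (use uc e in \<open>auto intro!: continuous_intros\<close>)
  have "(LINT \<zeta>|arc_measure. u \<zeta>) \<le> (LINT \<zeta>|arc_measure. Re (poly (p + [:of_real e:]) \<zeta>))"
  proof (rule circle_integral_mono[OF uc])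
    fix z :: complex assume "norm z = 1"
    from p[OF this] have "u z - e / 2 - Re (poly p z) < e / 2" unfolding abs_less_iff by simp
    then show "u z \<le> Re (poly (p + [:of_real e:]) z)" by simp
  qed (intro continuous_intros)
  also have "\<dots> = Re (poly (p + [:of_real e:]) 0)"
    by (intro circle_mean_Re_holomorphic holomorphic_intros)
  also have "\<dots> \<le> 0 + e"
  proof -
    have "Re (poly p 0) \<le> 0"
    proof (rule superharmonic_power_minimum_principle[OF q R F F0])
      fix z :: complex assume "norm z = 1"
      from p[OF this] have "- (e / 2) < u z - e / 2 - Re (poly p z)" unfolding abs_less_iff by linarith
      then show "Re (poly p z) \<le> superharmonic_power q (F z)" by (simp add: u_def)
    qed
    then show ?thesis by simp
  qed
  finally show "(LINT \<zeta>|arc_measure. superharmonic_power q (F \<zeta>)) \<le> 0 + e" by (simp add: u_def)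
qed

section \<open>Area integrals over the unit disc\<close>

text \<open>This transports the invariance of Lebesgue measure under orthogonal maps from the Cartesian plane to the complex
  plane.\<close>

lemma real_pair_measure: "(lborel :: complex measure) = distr (lborel :: (real ^ 2) measure) borel (\<lambda>v. Complex (v $ 1) (v $ 2))"
proof (rule lborel_eqI)
  let ?T = "\<lambda>v::real^2. Complex (v $ 1) (v $ 2)"
  have T: "?T \<in> borel_measurable borel"
    by (intro borel_measurable_continuous_onI) (simp add: Complex_eq continuous_intros)
  fix l u :: complex assume le: "\<And>b. b \<in> Basis \<Longrightarrow> l \<bullet> b \<le> u \<bullet> b"
  have le': "Re l \<le> Re u" "Im l \<le> Im u" using le[of 1] le[of \<i>] by (auto simp: Basis_complex_def)
  have "?T -` box l u = box (vector [Re l, Im l]) (vector [Re u, Im u])"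
    by (auto simp: box_def Basis_complex_def Basis_vec_def forall_2 inner_axis)
  then have "emeasure (distr lborel borel ?T) (box l u) = emeasure lborel (box (vector [Re l, Im l] :: real ^ 2) (vector [Re u, Im u]))"
    using T by (simp add: emeasure_distr)
  also have "\<dots> = (\<Prod>b\<in>Basis. ((vector [Re u, Im u] - vector [Re l, Im l]) :: real ^ 2) \<bullet> b)"
    using le' by (subst emeasure_lborel_box_eq) (auto simp: Basis_vec_def inner_axis forall_2)
  also have "(\<Prod>b\<in>Basis. ((vector [Re u, Im u] - vector [Re l, Im l]) :: real ^ 2) \<bullet> b) = (Re u - Re l) * (Im u - Im l)"
  proof -
    have B: "(Basis :: (real ^ 2) set) = {axis 1 1, axis 2 1}" by (auto simp: Basis_vec_def UNIV_2)
    show ?thesis unfolding B by (simp add: inner_axis axis_eq_axis)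
  qed
  also have "\<dots> = (\<Prod>b\<in>Basis. (u - l) \<bullet> b)" by (simp add: Basis_complex_def)
  finally show "emeasure (distr lborel borel ?T) (box l u) = (\<Prod>b\<in>Basis. (u - l) \<bullet> b)" .
qed simp

lemma lborel_rotation_invariant:
  assumes a: "norm a = 1"
  shows "distr lborel borel (\<lambda>z::complex. a * z) = lborel"
proof -
  let ?T = "\<lambda>v::real^2. Complex (v $ 1) (v $ 2)"
  let ?S = "\<lambda>z::complex. vector [Re z, Im z] :: real ^ 2"
  have aa: "cnj a * a = 1" "a * cnj a = 1" using a by (auto simp: complex_norm_square[symmetric] mult.commute)
  have T: "?T \<in> borel_measurable borel"
    by (intro borel_measurable_continuous_onI) (simp add: Complex_eq continuous_intros)
  have M: "(\<lambda>z. a * z) \<in> borel_measurable borel"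
    by (intro borel_measurable_continuous_onI continuous_intros)
  have ST: "?S (?T v) = v" for v by (simp add: vec_eq_iff forall_2)
  have nT: "norm (?T v) = norm v" for v by (simp add: norm_vec_def L2_set_def UNIV_2 cmod_def)
  have TS: "?T (?S z) = z" for z by simp
  define g where "g = (\<lambda>v. ?S (cnj a * ?T v))"
  have g: "orthogonal_transformation g"
    unfolding orthogonal_transformation
  proof
    show "linear g" unfolding g_def by (rule linearI) (auto simp: vec_eq_iff forall_2 algebra_simps)
    have nS: "norm (?S z) = norm z" for z by (simp add: norm_vec_def L2_set_def UNIV_2 cmod_def)
    show "\<forall>v. norm (g v) = norm v" unfolding g_def nS norm_mult nT using a by simp
  qed
  have "lborel = distr (lborel :: (real ^ 2) measure) borel (\<lambda>v. a * ?T v)"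
  proof (rule lborel_eqI)
    fix l u :: complex assume le: "\<And>b. b \<in> Basis \<Longrightarrow> l \<bullet> b \<le> u \<bullet> b"
    let ?B = "?T -` box l u"
    have Bset: "?B \<in> sets borel" using measurable_sets[OF T, of "box l u"] by simp
    have eB: "emeasure lborel ?B = (\<Prod>b\<in>Basis. (u - l) \<bullet> b)"
    proof -
      have "emeasure lborel (box l u) = emeasure (distr (lborel :: (real ^ 2) measure) borel ?T) (box l u)"
        by (subst real_pair_measure) simp
      also have "\<dots> = emeasure lborel ?B" using T by (simp add: emeasure_distr)
      finally show ?thesis using le by (simp add: emeasure_lborel_box_eq)
    qed
    then have BL: "?B \<in> lmeasurable"
      using Bset by (intro fmeasurableI) auto
    have img: "(\<lambda>v. a * ?T v) -` box l u = g ` ?B"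
    proof (intro set_eqI iffI)
      fix v assume "v \<in> (\<lambda>v. a * ?T v) -` box l u"
      then have vB: "?S (a * ?T v) \<in> ?B" by (simp only: vimage_eq TS)
      have gv: "g (?S (a * ?T v)) = v"
        unfolding g_def TS mult.assoc[symmetric] aa mult_1_left ST ..
      from imageI[OF vB, of g] show "v \<in> g ` ?B" unfolding gv .
    next
      fix v assume "v \<in> g ` ?B"
      then obtain v' where v': "v' \<in> ?B" "v = g v'" by blast
      have "a * ?T v = ?T v'" unfolding v'(2) g_def TS mult.assoc[symmetric] aa mult_1_left ..
      then show "v \<in> (\<lambda>v. a * ?T v) -` box l u" using v'(1) by (simp only: vimage_eq)
    qed
    have aT: "(\<lambda>v. a * ?T v) \<in> borel_measurable borel" using measurable_compose[OF T M] .
    have gset: "g ` ?B \<in> sets borel" using measurable_sets[OF aT, of "box l u"] img by simp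
    have "emeasure (distr lborel borel (\<lambda>v. a * ?T v)) (box l u) = emeasure lborel (g ` ?B)"
      using aT by (simp add: emeasure_distr img)
    also have "\<dots> = emeasure lebesgue (g ` ?B)" using gset by simp
    also have "\<dots> = ennreal (measure lebesgue (g ` ?B))"
      using measurable_orthogonal_image[OF g BL] by (simp add: emeasure_eq_measure2)
    also have "measure lebesgue (g ` ?B) = measure lebesgue ?B" by (rule measure_orthogonal_image[OF g BL])
    also have "ennreal (measure lebesgue ?B) = emeasure lebesgue ?B" using BL by (simp add: emeasure_eq_measure2)
    also have "\<dots> = emeasure lborel ?B" using Bset by simp
    also note eB
    finally show "emeasure (distr lborel borel (\<lambda>v. a * ?T v)) (box l u) = (\<Prod>b\<in>Basis. (u - l) \<bullet> b)" .
  qed simp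
  also have "\<dots> = distr (distr (lborel :: (real ^ 2) measure) borel ?T) borel (\<lambda>z. a * z)"
    using T M by (simp add: distr_distr comp_def)
  also have "\<dots> = distr lborel borel (\<lambda>z. a * z)" by (subst real_pair_measure) simp
  finally show ?thesis by simp
qed

lemma integrable_on_disc:
  fixes \<phi> :: "complex \<Rightarrow> 'b::euclidean_space"
  assumes \<phi>: "continuous_on (cball 0 1) \<phi>"
  shows "set_integrable lborel unit_disc \<phi>"
proof -
  have "set_integrable lborel (cball 0 1) \<phi>" unfolding set_integrable_def by (intro borel_integrable_compact \<phi>) simp
  then show ?thesis by (rule set_integrable_subset) auto
qed

lemma disc_integral_rotate:
  fixes \<phi> :: "complex \<Rightarrow> 'b::euclidean_space"
  assumes a: "norm a = 1" and \<phi>: "\<phi> \<in> borel_measurable borel"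
  shows "(LINT z:unit_disc|lborel. \<phi> (a * z)) = (LINT z:unit_disc|lborel. \<phi> z)"
proof -
  have M: "(\<lambda>z. a * z) \<in> borel_measurable borel"
    by (intro borel_measurable_continuous_onI continuous_intros)
  have [measurable]: "(\<lambda>z. indicat_real unit_disc z *\<^sub>R \<phi> z) \<in> borel_measurable borel"
    using \<phi> by (intro borel_measurable_scaleR borel_measurable_indicator) auto
  have "(LINT z:unit_disc|lborel. \<phi> z) = (LINT z|distr lborel borel (\<lambda>z. a * z). indicat_real unit_disc z *\<^sub>R \<phi> z)"
    unfolding lborel_rotation_invariant[OF a] set_lebesgue_integral_def ..
  also have "\<dots> = (LINT z|lborel. indicat_real unit_disc (a * z) *\<^sub>R \<phi> (a * z))"
    using M by (intro integral_distr) auto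
  also have "\<dots> = (LINT z:unit_disc|lborel. \<phi> (a * z))"
    unfolding set_lebesgue_integral_def using a
    by (intro Bochner_Integration.integral_cong) (auto simp: indicator_def norm_mult)
  finally show ?thesis ..
qed

text \<open>The rotation by \<open>pi / (j - k)\<close> changes the sign of the integrand but not the integral.\<close>

lemma disc_integral_monomials_orthogonal:
  assumes "j \<noteq> k"
  shows "(LINT z:unit_disc|lborel. z ^ j * cnj z ^ k) = 0"
proof -
  define \<theta> where "\<theta> = pi / (real j - real k)"
  have jk: "real j - real k \<noteq> 0" using assms by simp
  have "cis \<theta> ^ j * cnj (cis \<theta>) ^ k = cis (real j * \<theta>) * cis (- (real k * \<theta>))"
    by (simp add: cis_cnj Complex.DeMoivre)
  also have "\<dots> = cis ((real j - real k) * \<theta>)" by (simp add: cis_mult algebra_simps)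
  also have "\<dots> = - 1" using jk by (simp add: \<theta>_def)
  finally have e: "cis \<theta> ^ j * cnj (cis \<theta>) ^ k = - 1" .
  have "(LINT z:unit_disc|lborel. z ^ j * cnj z ^ k) = (LINT z:unit_disc|lborel. (cis \<theta> * z) ^ j * cnj (cis \<theta> * z) ^ k)"
    by (rule disc_integral_rotate[symmetric]) (auto intro!: borel_measurable_continuous_onI continuous_intros)
  also have "\<dots> = (LINT z:unit_disc|lborel. (- 1) * (z ^ j * cnj z ^ k))"
  proof -
    have "(cis \<theta> * z) ^ j * cnj (cis \<theta> * z) ^ k = (cis \<theta> ^ j * cnj (cis \<theta>) ^ k) * (z ^ j * cnj z ^ k)" for z
      by (simp add: power_mult_distrib mult_ac)
    then show ?thesis unfolding e by simp
  qed
  also have "\<dots> = - (LINT z:unit_disc|lborel. z ^ j * cnj z ^ k)"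
    by (simp add: set_lebesgue_integral_def)
  finally show ?thesis by simp
qed

text \<open>A layer-cake computation: \<open>norm z ^ (2 * m)\<close> is the integral of \<open>2 * m * t ^ (2 * m - 1)\<close> over
  \<open>t \<le> norm z\<close>, and after exchanging the integrals the inner one is the area \<open>pi * (1 - t\<^sup>2)\<close> of an annulus.\<close>

lemma disc_integral_radial_power:
  "(LINT z:unit_disc|lborel. norm z ^ (2 * m)) = pi / (real m + 1)"
proof (cases "m = 0")
  case True
  then show ?thesis by (simp add: set_lebesgue_integral_def content_ball unit_ball_vol_2)
next
  case False
  define f where "f = (\<lambda>t::real. 2 * real m * t ^ (2 * m - 1))"
  define c where "c = real m / (real m + 1)"
  have c: "c * real (2 * m + 2) = 2 * real m" by (simp add: c_def field_simps)
  have FTC: "(\<integral>\<^sup>+t. ennreal (f t) * indicator {0..r} t \<partial>lborel) = ennreal (r ^ (2 * m))" if "0 \<le> r" for r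
  proof -
    have "(\<integral>\<^sup>+t. ennreal (f t) * indicator {0..r} t \<partial>lborel) = ennreal (r ^ (2 * m) - 0 ^ (2 * m))"
    proof (rule nn_integral_FTC_Icc[OF _ _ _ that])
      show "f \<in> borel_measurable borel" unfolding f_def by measurable
      fix x :: real assume "x \<in> {0..r}"
      then show "0 \<le> f x" by (simp add: f_def)
      show "((\<lambda>r. r ^ (2 * m)) has_real_derivative f x) (at x)"
        unfolding f_def by (auto intro!: derivative_eq_intros)
    qed
    then show ?thesis using False by (simp add: zero_power)
  qed
  have annulus: "emeasure lborel {z::complex. t \<le> norm z \<and> norm z < 1} = ennreal (pi * (1 - t\<^sup>2))" if "0 \<le> t" "t \<le> 1" for t
  proof -
    have "{z::complex. t \<le> norm z \<and> norm z < 1} = ball 0 1 - ball 0 t" by auto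
    then have "emeasure lborel {z::complex. t \<le> norm z \<and> norm z < 1} = emeasure lborel (ball 0 1 :: complex set) - emeasure lborel (ball 0 t :: complex set)"
      using that by (simp add: emeasure_Diff emeasure_ball subset_ball)
    also have "\<dots> = ennreal pi - ennreal (pi * t\<^sup>2)" using that by (simp add: emeasure_ball unit_ball_vol_2)
    also have "\<dots> = ennreal (pi * (1 - t\<^sup>2))" by (subst ennreal_minus) (auto simp: right_diff_distrib)
    finally show ?thesis .
  qed
  have "(\<integral>\<^sup>+z. ennreal (indicator unit_disc (z::complex) * norm z ^ (2 * m)) \<partial>lborel)
      = (\<integral>\<^sup>+z. (\<integral>\<^sup>+t. indicator {(z, t). norm z < 1 \<and> 0 \<le> t \<and> t \<le> norm z} (z::complex, t) * ennreal (f t) \<partial>lborel) \<partial>lborel)"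
  proof (rule nn_integral_cong)
    fix z :: complex
    show "ennreal (indicator unit_disc z * norm z ^ (2 * m)) = (\<integral>\<^sup>+t. indicator {(z, t). norm z < 1 \<and> 0 \<le> t \<and> t \<le> norm z} (z, t) * ennreal (f t) \<partial>lborel)"
    proof (cases "norm z < 1")
      case True
      then have "(\<integral>\<^sup>+t. indicator {(z, t). norm z < 1 \<and> 0 \<le> t \<and> t \<le> norm z} (z, t) * ennreal (f t) \<partial>lborel)
        = (\<integral>\<^sup>+t. ennreal (f t) * indicator {0..norm z} t \<partial>lborel)"
        by (intro nn_integral_cong) (auto simp: indicator_def)
      then show ?thesis using True by (simp add: FTC)
    qed simp
  qed
  also have "\<dots> = (\<integral>\<^sup>+t. (\<integral>\<^sup>+z. indicator {(z, t). norm z < 1 \<and> 0 \<le> t \<and> t \<le> norm z} (z::complex, t) * ennreal (f t) \<partial>lborel) \<partial>lborel)"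
  proof (rule lborel_pair.Fubini'[symmetric])
    have "closed ({p::complex \<times> real. 0 \<le> snd p} \<inter> {p. snd p \<le> norm (fst p)})"
      by (intro closed_Int closed_Collect_le continuous_intros)
    moreover have "open {p::complex \<times> real. norm (fst p) < 1}"
      by (intro open_Collect_less continuous_intros)
    ultimately have "{p::complex \<times> real. norm (fst p) < 1} \<inter> ({p. 0 \<le> snd p} \<inter> {p. snd p \<le> norm (fst p)}) \<in> sets borel"
      by (intro sets.Int[OF borel_open borel_closed])
    moreover have "{p::complex \<times> real. norm (fst p) < 1} \<inter> ({p. 0 \<le> snd p} \<inter> {p. snd p \<le> norm (fst p)})
        = {(z, t). norm z < 1 \<and> 0 \<le> t \<and> t \<le> norm z}" by auto
    ultimately have [measurable]: "{(z::complex, t). norm z < 1 \<and> 0 \<le> t \<and> t \<le> norm z} \<in> sets (lborel \<Otimes>\<^sub>M lborel)"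
      unfolding lborel_prod sets_lborel by (simp only:)
    show "(\<lambda>(z, t). indicator {(z, t). norm z < 1 \<and> 0 \<le> t \<and> t \<le> norm z} (z::complex, t) * ennreal (f t))
        \<in> borel_measurable (lborel \<Otimes>\<^sub>M lborel)"
      unfolding f_def by measurable
  qed
  also have "\<dots> = (\<integral>\<^sup>+t. ennreal (pi * (f t * (1 - t\<^sup>2))) * indicator {0..1} t \<partial>lborel)"
  proof (rule nn_integral_cong)
    fix t :: real
    show "(\<integral>\<^sup>+z. indicator {(z, t). norm z < 1 \<and> 0 \<le> t \<and> t \<le> norm z} (z::complex, t) * ennreal (f t) \<partial>lborel)
        = ennreal (pi * (f t * (1 - t\<^sup>2))) * indicator {0..1} t"
    proof (cases "0 \<le> t \<and> t \<le> 1")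
      case True
      have "(\<integral>\<^sup>+z. indicator {(z, t). norm z < 1 \<and> 0 \<le> t \<and> t \<le> norm z} (z::complex, t) * ennreal (f t) \<partial>lborel)
        = (\<integral>\<^sup>+z. ennreal (f t) * indicator {z::complex. t \<le> norm z \<and> norm z < 1} z \<partial>lborel)"
        using True by (intro nn_integral_cong) (auto simp: indicator_def)
      also have "\<dots> = ennreal (f t) * ennreal (pi * (1 - t\<^sup>2))"
        using True by (subst nn_integral_cmult_indicator) (auto simp: annulus)
      finally show ?thesis using True by (simp add: ennreal_mult'[symmetric] f_def power_le_one mult_ac)
    next
      case False
      then have "indicator {(z, t). norm z < 1 \<and> 0 \<le> t \<and> t \<le> norm z} (z::complex, t) = (0::ennreal)" for z
        by (auto simp: indicator_def)
      then show ?thesis using False by simp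
    qed
  qed
  also have "\<dots> = ennreal (pi * (1 ^ (2 * m) - c * 1 ^ (2 * m + 2)) - pi * (0 ^ (2 * m) - c * 0 ^ (2 * m + 2)))"
  proof (rule nn_integral_FTC_Icc)
    show "(\<lambda>t. pi * (f t * (1 - t\<^sup>2))) \<in> borel_measurable borel" unfolding f_def by measurable
    fix x :: real assume x: "x \<in> {0..1}"
    then show "0 \<le> pi * (f x * (1 - x\<^sup>2))" by (simp add: f_def power_le_one)
    show "((\<lambda>r. pi * (r ^ (2 * m) - c * r ^ (2 * m + 2))) has_real_derivative pi * (f x * (1 - x\<^sup>2))) (at x)"
    proof -
      have "((\<lambda>r. pi * (r ^ (2 * m) - c * r ^ (2 * m + 2))) has_real_derivative
          pi * (real (2 * m) * x ^ (2 * m - 1) - c * (real (2 * m + 2) * x ^ (2 * m + 2 - 1)))) (at x)"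
        using DERIV_pow[of "2 * m" x] DERIV_pow[of "2 * m + 2" x]
        by (intro DERIV_cmult DERIV_diff) (simp_all only: One_nat_def)
      moreover have "x ^ (2 * m + 2 - 1) = x ^ (2 * m - 1) * x\<^sup>2"
        unfolding power_add[symmetric] using False by (intro arg_cong[of _ _ "power x"]) simp
      moreover have "c * (real (2 * m + 2) * (x ^ (2 * m - 1) * x\<^sup>2)) = (c * real (2 * m + 2)) * (x ^ (2 * m - 1) * x\<^sup>2)"
        by (simp only: mult.assoc)
      moreover have "pi * (real (2 * m) * x ^ (2 * m - 1) - 2 * real m * (x ^ (2 * m - 1) * x\<^sup>2)) = pi * (f x * (1 - x\<^sup>2))"
        by (simp add: f_def right_diff_distrib)
      ultimately show ?thesis by (simp only: c)
    qed
  qed simp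
  also have "\<dots> = ennreal (pi / (real m + 1))"
  proof -
    have "1 - c = 1 / (real m + 1)" by (simp add: c_def field_simps)
    then show ?thesis using False by (simp add: zero_power)
  qed
  finally have "(\<integral>\<^sup>+z. ennreal (indicator unit_disc (z::complex) * norm z ^ (2 * m)) \<partial>lborel) = ennreal (pi / (real m + 1))" .
  moreover have "(\<lambda>z::complex. indicat_real unit_disc z * norm z ^ (2 * m)) \<in> borel_measurable borel"
    by (intro borel_measurable_times borel_measurable_indicator borel_measurable_power borel_measurable_norm) auto
  ultimately show ?thesis
    unfolding set_lebesgue_integral_def
    by (intro integral_eq_nn_integral[THEN trans]) auto
qed

section \<open>The isoperimetric inequality\<close>

lemma circle_integral_monomials:
  "(LINT \<zeta>|arc_measure. \<zeta> ^ j * cnj \<zeta> ^ k) = (if j = k then 1 else 0)"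
proof -
  have eq: "(LINT \<zeta>|arc_measure. \<phi> \<zeta>) = (LINT \<zeta>|arc_measure. \<psi> \<zeta>)"
    if "\<And>z. norm z = 1 \<Longrightarrow> \<phi> z = \<psi> z" for \<phi> \<psi> :: "complex \<Rightarrow> complex"
    using that by (intro Bochner_Integration.integral_cong) (auto simp: arc_measure_def space_restrict_space)
  have zz: "z * cnj z = 1" if "norm z = 1" for z using that by (simp add: complex_norm_square[symmetric])
  show ?thesis
  proof (cases "k \<le> j")
    case True
    have "(LINT \<zeta>|arc_measure. \<zeta> ^ j * cnj \<zeta> ^ k) = (LINT \<zeta>|arc_measure. \<zeta> ^ (j - k))"
    proof (rule eq)
      fix z :: complex assume z: "norm z = 1"
      have "z ^ j * cnj z ^ k = z ^ (j - k) * (z * cnj z) ^ k"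
        using True by (simp add: power_mult_distrib power_add[symmetric] mult.assoc[symmetric])
      then show "z ^ j * cnj z ^ k = z ^ (j - k)" by (simp add: zz[OF z])
    qed
    also have "\<dots> = 0 ^ (j - k)" by (rule circle_mean_holomorphic) (intro holomorphic_intros)
    finally show ?thesis using True by (auto simp: zero_power)
  next
    case False
    have "(LINT \<zeta>|arc_measure. \<zeta> ^ j * cnj \<zeta> ^ k) = (LINT \<zeta>|arc_measure. cnj (\<zeta> ^ (k - j)))"
    proof (rule eq)
      fix z :: complex assume z: "norm z = 1"
      have "z ^ j * cnj z ^ k = cnj z ^ (k - j) * (z * cnj z) ^ j"
        using False by (simp add: power_mult_distrib power_add[symmetric] mult.assoc[symmetric] mult.commute[of "z ^ j"])
      then show "z ^ j * cnj z ^ k = cnj (z ^ (k - j))" by (simp add: zz[OF z])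
    qed
    also have "\<dots> = cnj (LINT \<zeta>|arc_measure. \<zeta> ^ (k - j))" by (rule Bochner_Integration.integral_cnj[of arc_measure "\<lambda>\<zeta>. \<zeta> ^ (k - j)"])
    also have "(LINT \<zeta>|arc_measure. \<zeta> ^ (k - j)) = 0 ^ (k - j)"
      by (rule circle_mean_holomorphic) (intro holomorphic_intros)
    finally show ?thesis using False by (auto simp: zero_power)
  qed
qed

lemma norm_poly_square_expand:
  "complex_of_real (norm (poly p z) ^ 2)
     = (\<Sum>j\<le>degree p. \<Sum>k\<le>degree p. coeff p j * cnj (coeff p k) * (z ^ j * cnj z ^ k))"
proof -
  have "complex_of_real (norm (poly p z) ^ 2) = poly p z * cnj (poly p z)" by (rule complex_norm_square)
  also have "\<dots> = (\<Sum>j\<le>degree p. coeff p j * z ^ j) * (\<Sum>k\<le>degree p. cnj (coeff p k) * cnj z ^ k)"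
    by (simp add: poly_altdef)
  also have "\<dots> = (\<Sum>j\<le>degree p. \<Sum>k\<le>degree p. coeff p j * cnj (coeff p k) * (z ^ j * cnj z ^ k))"
    unfolding sum_product by (intro sum.cong refl) (simp add: mult_ac)
  finally show ?thesis .
qed

lemma circle_integral_norm_poly_square:
  "(LINT \<zeta>|arc_measure. norm (poly p \<zeta>) ^ 2) = (\<Sum>k\<le>degree p. norm (coeff p k) ^ 2)"
proof -
  have int: "integrable arc_measure (\<lambda>\<zeta>. c * (\<zeta> ^ j * cnj \<zeta> ^ k))" for c j k
    by (intro integrable_arc_measure continuous_intros)
  have "complex_of_real (LINT \<zeta>|arc_measure. norm (poly p \<zeta>) ^ 2)
      = (LINT \<zeta>|arc_measure. complex_of_real (norm (poly p \<zeta>) ^ 2))" by (rule integral_complex_of_real[symmetric])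
  also have "\<dots> = (\<Sum>j\<le>degree p. \<Sum>k\<le>degree p. coeff p j * cnj (coeff p k) * (LINT \<zeta>|arc_measure. \<zeta> ^ j * cnj \<zeta> ^ k))"
    unfolding norm_poly_square_expand by (simp add: integral_sum int integrable_sum)
  also have "\<dots> = (\<Sum>j\<le>degree p. coeff p j * cnj (coeff p j))"
    unfolding circle_integral_monomials by (intro sum.cong refl) (simp add: sum.delta if_distrib cong: if_cong)
  also have "\<dots> = complex_of_real (\<Sum>k\<le>degree p. norm (coeff p k) ^ 2)" by (simp only: of_real_sum complex_norm_square)
  finally show ?thesis by (simp only: of_real_eq_iff)
qed

lemma disc_integral_norm_poly_square:
  "(LINT z:unit_disc|lborel. norm (poly p z) ^ 2) = pi * (\<Sum>k\<le>degree p. norm (coeff p k) ^ 2 / (real k + 1))"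
proof -
  have int: "integrable lborel (\<lambda>z. indicat_real unit_disc z *\<^sub>R (c * (z ^ j * cnj z ^ k)))" for c j k
    by (rule integrable_on_disc[unfolded set_integrable_def]) (intro continuous_intros)
  have diag: "(LINT z:unit_disc|lborel. z ^ j * cnj z ^ k) = (if j = k then of_real (pi / (real k + 1)) else 0)" for j k
  proof (cases "j = k")
    case True
    have "(LINT z:unit_disc|lborel. z ^ j * cnj z ^ k) = (LINT z:unit_disc|lborel. complex_of_real (norm z ^ (2 * k)))"
      unfolding True by (simp add: power_mult_distrib[symmetric] complex_norm_square[symmetric] power_mult)
    then show ?thesis using True by (simp only: set_integral_complex_of_real disc_integral_radial_power if_True refl)
  qed (simp add: disc_integral_monomials_orthogonal)
  have "complex_of_real (LINT z:unit_disc|lborel. norm (poly p z) ^ 2)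
      = (LINT z:unit_disc|lborel. complex_of_real (norm (poly p z) ^ 2))" by (rule set_integral_complex_of_real[symmetric])
  also have "\<dots> = (\<Sum>j\<le>degree p. \<Sum>k\<le>degree p. coeff p j * cnj (coeff p k) * (LINT z:unit_disc|lborel. z ^ j * cnj z ^ k))"
  proof -
    have "(LINT z:unit_disc|lborel. complex_of_real (norm (poly p z) ^ 2))
      = (LINT z|lborel. (\<Sum>j\<le>degree p. \<Sum>k\<le>degree p. indicat_real unit_disc z *\<^sub>R (coeff p j * cnj (coeff p k) * (z ^ j * cnj z ^ k))))"
      unfolding norm_poly_square_expand set_lebesgue_integral_def by (simp only: scaleR_sum_right)
    also have "\<dots> = (\<Sum>j\<le>degree p. \<Sum>k\<le>degree p. (LINT z|lborel. indicat_real unit_disc z *\<^sub>R (coeff p j * cnj (coeff p k) * (z ^ j * cnj z ^ k))))"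
      by (simp only: Bochner_Integration.integral_sum int Bochner_Integration.integrable_sum)
    also have "\<dots> = (\<Sum>j\<le>degree p. \<Sum>k\<le>degree p. coeff p j * cnj (coeff p k) * (LINT z:unit_disc|lborel. z ^ j * cnj z ^ k))"
      unfolding set_lebesgue_integral_def
      by (intro sum.cong refl) (simp only: mult_scaleR_right[symmetric] integral_mult_right_zero)
    finally show ?thesis .
  qed
  also have "\<dots> = (\<Sum>j\<le>degree p. coeff p j * cnj (coeff p j) * of_real (pi / (real j + 1)))"
    unfolding diag by (intro sum.cong refl) (simp add: sum.delta if_distrib cong: if_cong)
  also have "\<dots> = complex_of_real (\<Sum>k\<le>degree p. norm (coeff p k) ^ 2 * (pi / (real k + 1)))"
    by (simp only: of_real_sum of_real_mult complex_norm_square)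
  finally have "(LINT z:unit_disc|lborel. norm (poly p z) ^ 2) = (\<Sum>k\<le>degree p. norm (coeff p k) ^ 2 * (pi / (real k + 1)))"
    by (simp only: of_real_eq_iff)
  then show ?thesis by (simp add: sum_distrib_left mult.commute)
qed

text \<open>Both sides are expressed by Taylor coefficients. The coefficient of \<open>z ^ k\<close> in \<open>p * p\<close> is a sum of
  \<open>k + 1\<close> products, so by Cauchy--Schwarz its square is at most \<open>k + 1\<close> times a coefficient of \<open>A * A\<close>, where
  \<open>A\<close> has the coefficients \<open>norm (coeff p k) ^ 2\<close>. The factor \<open>k + 1\<close> cancels against the one from the area
  integral.\<close>

lemma carleman_poly:
  "(LINT z:unit_disc|lborel. norm (poly p z) ^ 4) \<le> pi * (LINT \<zeta>|arc_measure. norm (poly p \<zeta>) ^ 2) ^ 2"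
proof -
  \<comment> \<open>The sum of the coefficients of \<open>A * A\<close> is its value at \<open>1\<close>.\<close>
  define A where "A = map_poly (\<lambda>a. norm a ^ 2) p"
  have cA: "coeff A k = norm (coeff p k) ^ 2" for k by (simp add: A_def coeff_map_poly)
  have dA: "degree A = degree p" unfolding A_def by (intro degree_map_poly) auto
  have dAA: "degree (A * A) = degree (p * p)"
    by (cases "p = 0") (auto simp: degree_mult_eq A_def map_poly_eq_0_iff dA[unfolded A_def])
  have "(LINT z:unit_disc|lborel. norm (poly p z) ^ 4) = (LINT z:unit_disc|lborel. norm (poly (p * p) z) ^ 2)"
    by (simp add: norm_mult power_mult_distrib power_add[symmetric])
  also have "\<dots> = pi * (\<Sum>k\<le>degree (p * p). norm (coeff (p * p) k) ^ 2 / (real k + 1))"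
    by (rule disc_integral_norm_poly_square)
  also have "\<dots> \<le> pi * (\<Sum>k\<le>degree (p * p). coeff (A * A) k)"
  proof (intro mult_left_mono sum_mono)
    fix k
    have "norm (coeff (p * p) k) \<le> (\<Sum>i\<le>k. norm (coeff p i * coeff p (k - i)))"
      unfolding coeff_mult by (rule norm_sum)
    then have "norm (coeff (p * p) k) ^ 2 \<le> (\<Sum>i\<le>k. norm (coeff p i * coeff p (k - i))) ^ 2"
      by (intro power_mono) auto
    also have "\<dots> \<le> (\<Sum>i\<le>k. norm (coeff p i * coeff p (k - i)) ^ 2) * card {..k}"
      by (rule sum_squared_le_sum_of_squares)
    also have "\<dots> = coeff (A * A) k * (real k + 1)"
      unfolding coeff_mult cA by (simp add: norm_mult power_mult_distrib)
    finally show "norm (coeff (p * p) k) ^ 2 / (real k + 1) \<le> coeff (A * A) k" by (simp add: field_simps)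
  qed simp
  also have "(\<Sum>k\<le>degree (p * p). coeff (A * A) k) = poly (A * A) 1" unfolding dAA[symmetric] by (simp add: poly_altdef)
  also have "\<dots> = poly A 1 ^ 2" by (simp add: power2_eq_square)
  also have "poly A 1 = (\<Sum>k\<le>degree p. norm (coeff p k) ^ 2)" by (simp add: poly_altdef dA cA)
  also have "\<dots> = (LINT \<zeta>|arc_measure. norm (poly p \<zeta>) ^ 2)" by (rule circle_integral_norm_poly_square[symmetric])
  finally show ?thesis .
qed

text \<open>Pointwise convergence with a uniform bound is what dominated convergence needs to pass from polynomials to
  functions holomorphic beyond the closed disc.\<close>

lemma taylor_polynomials_converge_dominated:
  assumes K: "K holomorphic_on ball 0 R" and R: "1 < R"
  obtains P :: "nat \<Rightarrow> complex poly" and B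
  where "\<And>z. norm z \<le> 1 \<Longrightarrow> (\<lambda>N. poly (P N) z) \<longlonglongrightarrow> K z"
    and "\<And>N z. norm z \<le> 1 \<Longrightarrow> norm (poly (P N) z) \<le> B"
    and "\<And>N. poly (P N) 0 = K 0"
proof -
  define a where "a = (\<lambda>n. (deriv ^^ n) K 0 / fact n)"
  have sums: "(\<lambda>n. a n * z ^ n) sums K z" if "norm z < R" for z
    using holomorphic_power_series[OF K, of z] that by (simp add: a_def)
  define P where "P = (\<lambda>N. \<Sum>n<Suc N. monom (a n) n)"
  have polyP: "poly (P N) z = (\<Sum>n<Suc N. a n * z ^ n)" for N z
    by (simp only: P_def poly_sum poly_monom)
  define \<rho> where "\<rho> = (1 + R) / 2"
  have \<rho>: "1 < \<rho>" "\<rho> < R" using R by (auto simp: \<rho>_def)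
  have "summable (\<lambda>n. a n * of_real \<rho> ^ n)" using sums[of "of_real \<rho>"] \<rho> by (intro sums_summable) auto
  then have "ereal (norm (complex_of_real \<rho>)) \<le> conv_radius a" by (rule conv_radius_geI)
  then have "ereal (norm (1::complex)) < conv_radius a" by (rule less_le_trans[rotated]) (use \<rho> in simp)
  then have "summable (\<lambda>n. norm (a n * 1 ^ n))" by (rule abs_summable_in_conv_radius)
  then have sa: "summable (\<lambda>n. norm (a n))" by simp
  show ?thesis
  proof (rule that)
    show "(\<lambda>N. poly (P N) z) \<longlonglongrightarrow> K z" if "norm z \<le> 1" for z
      using sums[of z] that R unfolding polyP sums_def by (intro LIMSEQ_Suc) auto
    show "norm (poly (P N) z) \<le> (\<Sum>n. norm (a n))" if "norm z \<le> 1" for N z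
    proof -
      have "norm (poly (P N) z) \<le> (\<Sum>n<Suc N. norm (a n * z ^ n))" unfolding polyP by (rule norm_sum)
      also have "\<dots> \<le> (\<Sum>n<Suc N. norm (a n))"
        using that by (intro sum_mono) (simp add: norm_mult norm_power mult_left_le power_le_one)
      also have "\<dots> \<le> (\<Sum>n. norm (a n))" by (rule sum_le_suminf[OF sa]) auto
      finally show ?thesis .
    qed
    show "poly (P N) 0 = K 0" for N
      using sums_unique2[OF sums[of 0] powser_sums_zero[of a]] R
      unfolding polyP by (simp add: sum.lessThan_Suc_shift)
  qed
qed

lemma disc_integral_holomorphic:
  assumes W: "W holomorphic_on ball 0 R" and R: "1 < R"
  shows "(LINT z:unit_disc|lborel. W z) = of_real pi * W 0"
proof -
  have mono: "(LINT z:unit_disc|lborel. z ^ k) = (if k = 0 then of_real pi else 0)" for k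
  proof (cases "k = 0")
    case True
    have "(LINT z:unit_disc|lborel. complex_of_real 1) = complex_of_real (LINT z:unit_disc|lborel. 1)"
      by (rule set_integral_complex_of_real)
    then show ?thesis using True disc_integral_radial_power[of 0] by simp
  next
    case False
    then show ?thesis using disc_integral_monomials_orthogonal[of k 0] by simp
  qed
  have int: "integrable lborel (\<lambda>z. indicat_real unit_disc z *\<^sub>R (c * z ^ k))" for c :: complex and k
    by (rule integrable_on_disc[unfolded set_integrable_def]) (intro continuous_intros)
  have poly: "(LINT z:unit_disc|lborel. poly p z) = of_real pi * poly p 0" for p
  proof -
    have "(LINT z:unit_disc|lborel. poly p z) = (\<Sum>k\<le>degree p. (LINT z|lborel. indicat_real unit_disc z *\<^sub>R (coeff p k * z ^ k)))"
      unfolding poly_altdef set_lebesgue_integral_def scaleR_sum_right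
      by (simp only: Bochner_Integration.integral_sum int)
    also have "\<dots> = (\<Sum>k\<le>degree p. coeff p k * (LINT z:unit_disc|lborel. z ^ k))"
      unfolding set_lebesgue_integral_def
      by (intro sum.cong refl) (simp only: mult_scaleR_right[symmetric] integral_mult_right_zero)
    also have "\<dots> = of_real pi * poly p 0"
      unfolding mono by (simp add: if_distrib sum.delta poly_0_coeff_0 mult.commute cong: if_cong)
    finally show ?thesis .
  qed
  obtain P B where P: "\<And>z. norm z \<le> 1 \<Longrightarrow> (\<lambda>N. poly (P N) z) \<longlonglongrightarrow> W z"
      "\<And>N z. norm z \<le> 1 \<Longrightarrow> norm (poly (P N) z) \<le> B" "\<And>N. poly (P N) 0 = W 0"
    using taylor_polynomials_converge_dominated[OF W R] by metis
  have Wc: "continuous_on (cball 0 1) W"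
    using R by (intro holomorphic_on_imp_continuous_on holomorphic_on_subset[OF W]) auto
  have "(\<lambda>N. LINT z:unit_disc|lborel. poly (P N) z) \<longlonglongrightarrow> (LINT z:unit_disc|lborel. W z)"
    unfolding set_lebesgue_integral_def
  proof (rule integral_dominated_convergence[where w = "\<lambda>z. indicat_real unit_disc z *\<^sub>R B"])
    show "integrable lborel (\<lambda>z. indicat_real unit_disc (z::complex) *\<^sub>R B)"
      by (rule integrable_on_disc[unfolded set_integrable_def]) (intro continuous_intros)
    show "(\<lambda>z. indicat_real unit_disc z *\<^sub>R W z) \<in> borel_measurable lborel"
      by (rule borel_measurable_integrable[OF integrable_on_disc[unfolded set_integrable_def]]) (intro Wc)
    show "(\<lambda>z. indicat_real unit_disc z *\<^sub>R poly (P N) z) \<in> borel_measurable lborel" for N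
      by (rule borel_measurable_integrable[OF integrable_on_disc[unfolded set_integrable_def]]) (intro continuous_intros)
    show "AE z in lborel. (\<lambda>N. indicat_real unit_disc z *\<^sub>R poly (P N) z) \<longlonglongrightarrow> indicat_real unit_disc z *\<^sub>R W z"
      using P(1) by (intro AE_I2) (auto simp: indicator_def)
    show "AE z in lborel. norm (indicat_real unit_disc z *\<^sub>R poly (P N) z) \<le> indicat_real unit_disc z *\<^sub>R B" for N
      using P(2)[of _ N] by (intro AE_I2) (auto simp: indicator_def)
  qed
  then show ?thesis unfolding poly P(3) by (simp add: LIMSEQ_const_iff)
qed

lemma carleman_inequality:
  assumes K: "K holomorphic_on ball 0 R" and R: "1 < R"
  shows "(LINT z:unit_disc|lborel. norm (K z) ^ 4) \<le> pi * (LINT \<zeta>|arc_measure. norm (K \<zeta>) ^ 2) ^ 2"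
proof -
  obtain P B where lim: "\<And>z. norm z \<le> 1 \<Longrightarrow> (\<lambda>N. poly (P N) z) \<longlonglongrightarrow> K z"
      and bound: "\<And>N z. norm z \<le> 1 \<Longrightarrow> norm (poly (P N) z) \<le> B"
    using taylor_polynomials_converge_dominated[OF K R] by metis
  have Kc: "continuous_on (cball 0 1) K"
    using R by (intro holomorphic_on_imp_continuous_on holomorphic_on_subset[OF K]) auto
  have Kcs: "continuous_on (sphere 0 1) K" using Kc by (rule continuous_on_subset) auto
  have disc: "(\<lambda>N. LINT z:unit_disc|lborel. norm (poly (P N) z) ^ 4) \<longlonglongrightarrow> (LINT z:unit_disc|lborel. norm (K z) ^ 4)"
    unfolding set_lebesgue_integral_def
  proof (rule integral_dominated_convergence[where w = "\<lambda>z. indicat_real unit_disc z *\<^sub>R B ^ 4"])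
    show "integrable lborel (\<lambda>z. indicat_real unit_disc (z::complex) *\<^sub>R B ^ 4)"
      by (rule integrable_on_disc[unfolded set_integrable_def]) (intro continuous_intros)
    show "(\<lambda>z. indicat_real unit_disc z *\<^sub>R norm (K z) ^ 4) \<in> borel_measurable lborel"
      by (rule borel_measurable_integrable[OF integrable_on_disc[unfolded set_integrable_def]]) (intro continuous_intros Kc)
    show "(\<lambda>z. indicat_real unit_disc z *\<^sub>R norm (poly (P N) z) ^ 4) \<in> borel_measurable lborel" for N
      by (rule borel_measurable_integrable[OF integrable_on_disc[unfolded set_integrable_def]]) (intro continuous_intros)
    show "AE z in lborel. (\<lambda>N. indicat_real unit_disc z *\<^sub>R norm (poly (P N) z) ^ 4) \<longlonglongrightarrow> indicat_real unit_disc z *\<^sub>R norm (K z) ^ 4"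
      using lim by (intro AE_I2) (auto simp: indicator_def intro!: tendsto_intros)
    show "AE z in lborel. norm (indicat_real unit_disc z *\<^sub>R norm (poly (P N) z) ^ 4) \<le> indicat_real unit_disc z *\<^sub>R B ^ 4" for N
      using bound[of _ N] by (intro AE_I2) (auto simp: indicator_def intro!: power_mono)
  qed
  have circ: "(\<lambda>N. LINT \<zeta>|arc_measure. norm (poly (P N) \<zeta>) ^ 2) \<longlonglongrightarrow> (LINT \<zeta>|arc_measure. norm (K \<zeta>) ^ 2)"
  proof (rule integral_dominated_convergence[where w = "\<lambda>_. B ^ 2"])
    show "integrable arc_measure (\<lambda>_. B ^ 2)" by (intro integrable_arc_measure continuous_intros)
    show "(\<lambda>z. norm (K z) ^ 2) \<in> borel_measurable arc_measure"
      by (intro borel_measurable_integrable integrable_arc_measure continuous_intros Kcs)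
    show "(\<lambda>z. norm (poly (P N) z) ^ 2) \<in> borel_measurable arc_measure" for N
      by (intro borel_measurable_integrable integrable_arc_measure continuous_intros)
    show "AE z in arc_measure. (\<lambda>N. norm (poly (P N) z) ^ 2) \<longlonglongrightarrow> norm (K z) ^ 2"
      by (intro AE_I2 tendsto_intros lim) (simp add: arc_measure_def space_restrict_space)
    show "AE z in arc_measure. norm (norm (poly (P N) z) ^ 2) \<le> B ^ 2" for N
      using bound[of _ N] by (intro AE_I2) (auto simp: arc_measure_def space_restrict_space intro!: power_mono)
  qed
  have "(\<lambda>N. pi * (LINT \<zeta>|arc_measure. norm (poly (P N) \<zeta>) ^ 2) ^ 2) \<longlonglongrightarrow> pi * (LINT \<zeta>|arc_measure. norm (K \<zeta>) ^ 2) ^ 2"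
    by (intro tendsto_intros circ)
  then show ?thesis by (rule LIMSEQ_le[OF disc]) (blast intro: carleman_poly)
qed


lemma two_term_cauchy_schwarz:
  "norm (a * cnj c + b * cnj d) \<le> sqrt (norm a ^ 2 + norm b ^ 2) * sqrt (norm c ^ 2 + norm d ^ 2)"
proof -
  have "norm (a * cnj c + b * cnj d) \<le> norm a * norm c + norm b * norm d"
    by (rule order_trans[OF norm_triangle_ineq]) (simp add: norm_mult)
  also have "\<dots> \<le> sqrt ((norm a ^ 2 + norm b ^ 2) * (norm c ^ 2 + norm d ^ 2))"
  proof (rule real_le_rsqrt)
    have "0 \<le> (norm a * norm d - norm b * norm c) ^ 2" by simp
    then show "(norm a * norm c + norm b * norm d) ^ 2 \<le> (norm a ^ 2 + norm b ^ 2) * (norm c ^ 2 + norm d ^ 2)"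
      by (simp add: power2_eq_square algebra_simps)
  qed
  finally show ?thesis by (simp add: real_sqrt_mult)
qed

text \<open>For fixed \<open>z0\<close> the inner product of \<open>(g z, h z)\<close> with \<open>(g z0, h z0)\<close> is holomorphic in \<open>z\<close>. The maximum
  modulus principle for its product with \<open>exp (- p z / 2)\<close>, together with Cauchy--Schwarz on the circle, gives the
  bound at \<open>z0\<close>.\<close>

lemma square_sum_maximum_principle:
  assumes g: "g holomorphic_on ball 0 R" and h: "h holomorphic_on ball 0 R" and R: "1 < R"
    and le: "\<And>z. norm z = 1 \<Longrightarrow> norm (g z) ^ 2 + norm (h z) ^ 2 \<le> exp (Re (poly p z))"
    and z0: "norm z0 < 1"
  shows "norm (g z0) ^ 2 + norm (h z0) ^ 2 \<le> exp (Re (poly p z0))"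
proof -
  define s where "s = norm (g z0) ^ 2 + norm (h z0) ^ 2"
  define \<phi> where "\<phi> = (\<lambda>z. (g z * cnj (g z0) + h z * cnj (h z0)) * exp (- (poly p z) / 2))"
  have s0: "0 \<le> s" by (simp add: s_def)
  have \<phi>h: "\<phi> holomorphic_on ball 0 R" unfolding \<phi>_def by (intro holomorphic_intros g h) auto
  have "norm (\<phi> z0) \<le> sqrt s"
  proof (rule maximum_modulus_frontier[of \<phi> "ball 0 1"])
    show "\<phi> holomorphic_on interior (ball 0 1)" using R by (intro holomorphic_on_subset[OF \<phi>h]) auto
    show "continuous_on (closure (ball 0 1)) \<phi>"
      using R by (intro holomorphic_on_imp_continuous_on holomorphic_on_subset[OF \<phi>h]) auto
    fix z :: complex assume "z \<in> frontier (ball 0 1)"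
    then have z: "norm z = 1" by (simp add: frontier_ball)
    have "norm (\<phi> z) = norm (g z * cnj (g z0) + h z * cnj (h z0)) * exp (- Re (poly p z) / 2)"
      by (simp add: \<phi>_def norm_mult)
    also have "\<dots> \<le> (sqrt (norm (g z) ^ 2 + norm (h z) ^ 2) * sqrt s) * exp (- Re (poly p z) / 2)"
      unfolding s_def by (intro mult_right_mono two_term_cauchy_schwarz) simp
    also have "\<dots> \<le> (sqrt (exp (Re (poly p z))) * sqrt s) * exp (- Re (poly p z) / 2)"
      using s0 le[OF z] by (intro mult_right_mono real_sqrt_le_mono) auto
    also have "sqrt (exp (Re (poly p z))) = exp (Re (poly p z) / 2)"
      by (rule real_sqrt_unique) (simp_all add: power2_eq_square exp_add[symmetric])
    also have "exp (Re (poly p z) / 2) * sqrt s * exp (- Re (poly p z) / 2) = sqrt s"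
      by (simp add: exp_minus)
    finally show "norm (\<phi> z) \<le> sqrt s" .
  qed (use z0 in auto)
  moreover have "norm (\<phi> z0) = s * exp (- Re (poly p z0) / 2)"
  proof -
    have "\<phi> z0 = of_real s * exp (- (poly p z0) / 2)"
      by (simp add: \<phi>_def s_def complex_norm_square[symmetric])
    then show ?thesis using s0 by (simp add: norm_mult)
  qed
  ultimately have "s \<le> sqrt s * exp (Re (poly p z0) / 2)" by (simp add: exp_minus field_simps)
  then have le: "sqrt s * sqrt s \<le> sqrt s * exp (Re (poly p z0) / 2)" using s0 by simp
  have "sqrt s \<le> exp (Re (poly p z0) / 2)"
  proof (cases "s = 0")
    case False
    then have "0 < sqrt s" using s0 by simp
    from mult_le_cancel_left_pos[OF this] le show ?thesis by blast
  qed simp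
  then have "sqrt s ^ 2 \<le> exp (Re (poly p z0) / 2) ^ 2" using s0 by (intro power_mono) auto
  then show ?thesis using s0 unfolding s_def[symmetric] by (simp add: exp_double[symmetric])
qed

text \<open>A polynomial \<open>p\<close> with \<open>Re p\<close> slightly above \<open>ln s\<close> on the circle gives the zero-free function
  \<open>exp (q * p)\<close>. Its modulus majorises \<open>s powr q\<close> in the disc and is close to it on the circle, so Carleman's
  inequality for its square root \<open>exp (q * p / 2)\<close> yields the claim in the limit.\<close>

lemma square_sum_isoperimetric:
  assumes g: "g holomorphic_on ball 0 R" and h: "h holomorphic_on ball 0 R" and R: "1 < R" and q: "0 < q"
  defines "s \<equiv> (\<lambda>z. norm (g z) ^ 2 + norm (h z) ^ 2)"
  shows "(LINT z:unit_disc|lborel. s z powr (2 * q)) \<le> pi * (LINT \<zeta>|arc_measure. s \<zeta> powr q) ^ 2"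
proof -
  have cbR: "cball 0 1 \<subseteq> ball (0::complex) R" using R by (auto simp: subset_eq)
  have sc: "continuous_on (cball 0 1) s"
    unfolding s_def using cbR
    by (intro continuous_intros holomorphic_on_imp_continuous_on holomorphic_on_subset[OF g] holomorphic_on_subset[OF h])
  have scs: "continuous_on (sphere 0 1) s" using sc by (rule continuous_on_subset) auto
  have s0: "0 \<le> s z" for z by (simp add: s_def)
  have step: "(LINT z:unit_disc|lborel. s z powr (2 * q))
      \<le> pi * (LINT \<zeta>|arc_measure. (s \<zeta> + \<delta>) powr q * exp (q * \<delta>)) ^ 2" if \<delta>: "0 < \<delta>" for \<delta>
  proof -
    have pos: "0 < s z + \<delta>" for z using s0[of z] \<delta> by linarith
    \<comment> \<open>Adding \<open>\<delta>\<close> keeps the logarithm continuous at the zeros of \<open>s\<close>.\<close>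
    have lc: "continuous_on (sphere 0 1) (\<lambda>z. ln (s z + \<delta>) + \<delta> / 2)"
      using pos by (intro continuous_intros scs) (metis less_irrefl)
    obtain p where p: "\<And>z. norm z = 1 \<Longrightarrow> \<bar>ln (s z + \<delta>) + \<delta> / 2 - Re (poly p z)\<bar> < \<delta> / 2"
      using circle_Re_poly_dense[OF lc, of "\<delta> / 2"] \<delta> by auto
    have low: "s z \<le> exp (Re (poly p z))" if "norm z = 1" for z
    proof -
      have "ln (s z + \<delta>) \<le> Re (poly p z)" using p[OF that] by linarith
      then have "s z + \<delta> \<le> exp (Re (poly p z))" using pos by (metis exp_le_cancel_iff exp_ln)
      then show ?thesis using \<delta> by linarith
    qed
    have high: "exp (Re (poly p z)) \<le> (s z + \<delta>) * exp \<delta>" if "norm z = 1" for z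
    proof -
      have "Re (poly p z) \<le> ln (s z + \<delta>) + \<delta>" using p[OF that] by linarith
      then have "exp (Re (poly p z)) \<le> exp (ln (s z + \<delta>) + \<delta>)" by simp
      then show ?thesis using pos by (simp add: exp_add)
    qed
    have inside: "s z \<le> exp (Re (poly p z))" if "norm z < 1" for z
      using square_sum_maximum_principle[OF g h R low[unfolded s_def] that] by (simp add: s_def)
    define K where "K = (\<lambda>z. exp (of_real (q / 2) * poly p z))"
    have K: "K holomorphic_on ball 0 2" unfolding K_def by (intro holomorphic_intros)
    have K2: "norm (K z) ^ 2 = exp (Re (poly p z)) powr q" for z
      by (simp add: K_def powr_def exp_double[symmetric])
    have K4: "norm (K z) ^ 4 = exp (Re (poly p z)) powr (2 * q)" for z
    proof -
      have "norm (K z) ^ 4 = (norm (K z) ^ 2) ^ 2" by simp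
      also have "\<dots> = exp (Re (poly p z)) powr (2 * q)" unfolding K2 by (simp add: powr_def exp_double[symmetric])
      finally show ?thesis .
    qed
    have Kc: "continuous_on S K" for S unfolding K_def by (intro continuous_intros)
    have "(LINT z:unit_disc|lborel. s z powr (2 * q)) \<le> (LINT z:unit_disc|lborel. norm (K z) ^ 4)"
    proof (rule set_integral_mono)
      show "set_integrable lborel unit_disc (\<lambda>z. s z powr (2 * q))"
        using q s0 by (intro integrable_on_disc continuous_on_powr' sc continuous_intros) auto
      show "set_integrable lborel unit_disc (\<lambda>z. norm (K z) ^ 4)"
        by (intro integrable_on_disc continuous_intros Kc)
      show "s z powr (2 * q) \<le> norm (K z) ^ 4" if "z \<in> unit_disc" for z
        unfolding K4 using q s0 inside[of z] that by (intro powr_mono2) auto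
    qed
    also have "\<dots> \<le> pi * (LINT \<zeta>|arc_measure. norm (K \<zeta>) ^ 2) ^ 2" by (rule carleman_inequality[OF K]) simp
    also have "\<dots> \<le> pi * (LINT \<zeta>|arc_measure. (s \<zeta> + \<delta>) powr q * exp (q * \<delta>)) ^ 2"
    proof (intro mult_left_mono power_mono circle_integral_mono)
      show "continuous_on (sphere 0 1) (\<lambda>\<zeta>. norm (K \<zeta>) ^ 2)" by (intro continuous_intros Kc)
      show "continuous_on (sphere 0 1) (\<lambda>\<zeta>. (s \<zeta> + \<delta>) powr q * exp (q * \<delta>))"
        using pos by (intro continuous_intros continuous_on_powr scs) (metis less_irrefl)
      show "norm (K z) ^ 2 \<le> (s z + \<delta>) powr q * exp (q * \<delta>)" if "norm z = 1" for z
      proof -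
        have "norm (K z) ^ 2 \<le> ((s z + \<delta>) * exp \<delta>) powr q"
          unfolding K2 using q high[OF that] by (intro powr_mono2) auto
        also have "\<dots> = (s z + \<delta>) powr q * exp \<delta> powr q" using pos[of z] by (simp add: powr_mult)
        finally show ?thesis by (simp add: powr_def mult.commute)
      qed
      show "0 \<le> (LINT \<zeta>|arc_measure. norm (K \<zeta>) ^ 2)" by (intro integral_nonneg_AE AE_I2) simp
    qed simp
    finally show ?thesis .
  qed
  obtain B where B: "\<And>z. norm z = 1 \<Longrightarrow> s z \<le> B"
  proof -
    have "bounded (s ` sphere 0 1)" by (intro compact_imp_bounded compact_continuous_image scs) auto
    then obtain B where "\<forall>y\<in>s ` sphere 0 1. norm y \<le> B" unfolding bounded_iff by blast
    then show ?thesis by (intro that[of B]) force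
  qed
  define \<delta> where "\<delta> = (\<lambda>k. inverse (real (Suc k)))"
  have \<delta>: "0 < \<delta> k" "\<delta> k \<le> 1" "\<delta> \<longlonglongrightarrow> 0" for k
    using LIMSEQ_inverse_real_of_nat by (auto simp: \<delta>_def field_simps)
  have "(\<lambda>k. LINT \<zeta>|arc_measure. (s \<zeta> + \<delta> k) powr q * exp (q * \<delta> k)) \<longlonglongrightarrow> (LINT \<zeta>|arc_measure. s \<zeta> powr q)"
  proof (rule integral_dominated_convergence[where w = "\<lambda>_. (B + 1) powr q * exp q"])
    show "integrable arc_measure (\<lambda>_. (B + 1) powr q * exp q)" by (intro integrable_arc_measure continuous_intros)
    have "continuous_on (sphere 0 1) (\<lambda>\<zeta>. (s \<zeta> + c) powr q * exp (q * c))" if "0 \<le> c" for c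
      using q s0 that by (intro continuous_on_mult continuous_on_powr' continuous_on_add scs continuous_on_const) auto
    from integrable_arc_measure[OF this]
    have meas: "(\<lambda>\<zeta>. (s \<zeta> + c) powr q * exp (q * c)) \<in> borel_measurable arc_measure" if "0 \<le> c" for c
      using that by blast
    show "(\<lambda>\<zeta>. s \<zeta> powr q) \<in> borel_measurable arc_measure" using meas[of 0] by simp
    show "(\<lambda>\<zeta>. (s \<zeta> + \<delta> k) powr q * exp (q * \<delta> k)) \<in> borel_measurable arc_measure" for k
      using \<delta>(1)[of k] by (intro meas) simp
    show "AE \<zeta> in arc_measure. (\<lambda>k. (s \<zeta> + \<delta> k) powr q * exp (q * \<delta> k)) \<longlonglongrightarrow> s \<zeta> powr q"
    proof (rule AE_I2)
      fix \<zeta>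
      have "(\<lambda>k. (s \<zeta> + \<delta> k) powr q * exp (q * \<delta> k)) \<longlonglongrightarrow> (s \<zeta> + 0) powr q * exp (q * 0)"
        using q s0[of \<zeta>] \<delta>(1) by (intro tendsto_mult tendsto_powr' tendsto_exp tendsto_add tendsto_const \<delta>(3))
          (auto intro!: always_eventually add_nonneg_nonneg simp: less_imp_le)
      then show "(\<lambda>k. (s \<zeta> + \<delta> k) powr q * exp (q * \<delta> k)) \<longlonglongrightarrow> s \<zeta> powr q" by simp
    qed
    show "AE \<zeta> in arc_measure. norm ((s \<zeta> + \<delta> k) powr q * exp (q * \<delta> k)) \<le> (B + 1) powr q * exp q" for k
    proof (rule AE_I2)
      fix \<zeta> assume "\<zeta> \<in> space arc_measure"
      then have z: "norm \<zeta> = 1" by (simp add: arc_measure_def space_restrict_space)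
      have "norm ((s \<zeta> + \<delta> k) powr q * exp (q * \<delta> k)) = (s \<zeta> + \<delta> k) powr q * exp (q * \<delta> k)" by simp
      also have "\<dots> \<le> (B + 1) powr q * exp (q * 1)"
        using q s0[of \<zeta>] \<delta>(1,2)[of k] B[OF z]
        by (intro mult_mono powr_mono2) (auto simp: mult_left_le)
      finally show "norm ((s \<zeta> + \<delta> k) powr q * exp (q * \<delta> k)) \<le> (B + 1) powr q * exp q" by simp
    qed
  qed
  then have "(\<lambda>k. pi * (LINT \<zeta>|arc_measure. (s \<zeta> + \<delta> k) powr q * exp (q * \<delta> k)) ^ 2)
      \<longlonglongrightarrow> pi * (LINT \<zeta>|arc_measure. s \<zeta> powr q) ^ 2"
    by (intro tendsto_intros)
  then show ?thesis
    by (rule LIMSEQ_le_const) (use step \<delta>(1) in blast)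
qed

section \<open>Harmonic functions as sums of holomorphic and antiholomorphic ones\<close>

lemma C1_on_partial_x:
  assumes "C1_on f S" "Complex x y \<in> S"
  shows "((\<lambda>t. f (Complex t y)) has_vector_derivative partial_x f (Complex x y)) (at x)"
proof -
  have "((\<lambda>t::real. f (Complex x y + of_real t)) has_vector_derivative partial_x f (Complex x y)) (at (x - x))"
    using assms unfolding C1_on_def partial_x_def by (simp add: vector_derivative_works)
  then have "(((\<lambda>t::real. f (Complex x y + of_real t)) \<circ> (\<lambda>t. t - x)) has_vector_derivative 1 *\<^sub>R partial_x f (Complex x y)) (at x)"
    by (intro vector_diff_chain_at) (auto intro!: derivative_eq_intros simp: has_real_derivative_iff_has_vector_derivative[symmetric])
  moreover have "Complex x y + of_real (t - x) = Complex t y" for t by (simp add: complex_eq_iff)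
  ultimately show ?thesis by (simp add: comp_def)
qed

lemma C1_on_partial_y:
  assumes "C1_on f S" "Complex x y \<in> S"
  shows "((\<lambda>t. f (Complex x t)) has_vector_derivative partial_y f (Complex x y)) (at y)"
proof -
  have "((\<lambda>t::real. f (Complex x y + \<i> * of_real t)) has_vector_derivative partial_y f (Complex x y)) (at (y - y))"
    using assms unfolding C1_on_def partial_y_def by (simp add: vector_derivative_works)
  then have "(((\<lambda>t::real. f (Complex x y + \<i> * of_real t)) \<circ> (\<lambda>t. t - y)) has_vector_derivative 1 *\<^sub>R partial_y f (Complex x y)) (at y)"
    by (intro vector_diff_chain_at) (auto intro!: derivative_eq_intros simp: has_real_derivative_iff_has_vector_derivative[symmetric])
  moreover have "Complex x y + \<i> * of_real (t - y) = Complex x t" for t by (simp add: complex_eq_iff)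
  ultimately show ?thesis by (simp add: comp_def)
qed

lemma square_subset_open:
  assumes "open S" "z \<in> S"
  obtains d where "0 < d" "\<And>x y. \<bar>x - Re z\<bar> \<le> d \<Longrightarrow> \<bar>y - Im z\<bar> \<le> d \<Longrightarrow> Complex x y \<in> S"
proof -
  obtain e where e: "0 < e" "ball z e \<subseteq> S" using assms open_contains_ball by blast
  show ?thesis
  proof (rule that[of "e / 4"])
    fix x y assume xy: "\<bar>x - Re z\<bar> \<le> e / 4" "\<bar>y - Im z\<bar> \<le> e / 4"
    have "norm (Complex x y - z) \<le> \<bar>x - Re z\<bar> + \<bar>y - Im z\<bar>"
      using cmod_le[of "Complex x y - z"] by simp
    also have "\<dots> < e" using xy e by linarith
    finally show "Complex x y \<in> S" using e by (auto simp: dist_norm norm_minus_commute)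
  qed (use e in simp)
qed

lemma C1_on_has_derivative:
  assumes C1: "C1_on f S" and S: "open S" and z: "z \<in> S"
  shows "(f has_derivative (\<lambda>h. Re h *\<^sub>R partial_x f z + Im h *\<^sub>R partial_y f z)) (at z)"
proof -
  obtain d where d: "0 < d" "\<And>x y. \<bar>x - Re z\<bar> \<le> d \<Longrightarrow> \<bar>y - Im z\<bar> \<le> d \<Longrightarrow> Complex x y \<in> S"
    using square_subset_open[OF S z] by blast
  let ?X = "{Re z - d<..<Re z + d}" and ?Y = "{Im z - d<..<Im z + d}"
  have inS: "Complex x y \<in> S" if "x \<in> ?X" "y \<in> ?Y" for x y
    using that by (intro d(2)) auto
  have "((\<lambda>(x, y). f (Complex x y)) has_derivative
      (\<lambda>(tx, ty). tx *\<^sub>R partial_x f z + blinfun_apply (blinfun_scaleR_left (partial_y f (Complex (Re z) (Im z)))) ty))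
      (at (Re z, Im z) within ?X \<times> ?Y)"
  proof (rule has_derivative_partialsI[where f = "\<lambda>x y. f (Complex x y)" and fx = "\<lambda>t. t *\<^sub>R partial_x f z"
        and fy = "\<lambda>x y. blinfun_scaleR_left (partial_y f (Complex x y))"])
    show "((\<lambda>x. f (Complex x (Im z))) has_derivative (\<lambda>tx. tx *\<^sub>R partial_x f z)) (at (Re z) within ?X)"
      using C1_on_partial_x[OF C1, of "Re z" "Im z"] z
      unfolding has_vector_derivative_def complex_surj by (blast intro: has_derivative_at_withinI)
    show "((\<lambda>y. f (Complex x y)) has_derivative blinfun_apply (blinfun_scaleR_left (partial_y f (Complex x y)))) (at y within ?Y)"
      if "x \<in> ?X" "y \<in> ?Y" for x y
      using C1_on_partial_y[OF C1 inS[OF that]]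
      unfolding has_vector_derivative_def blinfun_scaleR_left.rep_eq by (rule has_derivative_at_withinI)
    have "continuous_on (?X \<times> ?Y) (\<lambda>p. partial_y f (Complex (fst p) (snd p)))"
    proof (rule continuous_on_compose2[of S "partial_y f"])
      show "continuous_on S (partial_y f)" using C1 by (simp add: C1_on_def)
      show "continuous_on (?X \<times> ?Y) (\<lambda>p. Complex (fst p) (snd p))"
        unfolding Complex_eq by (intro continuous_intros)
      show "(\<lambda>p. Complex (fst p) (snd p)) ` (?X \<times> ?Y) \<subseteq> S" using inS by auto
    qed
    then have "continuous_on (?X \<times> ?Y) (\<lambda>p. blinfun_scaleR_left (partial_y f (Complex (fst p) (snd p))))"
      by (intro bounded_linear.continuous_on[OF bounded_linear_blinfun_scaleR_left])
    then show "continuous (at (Re z, Im z) within ?X \<times> ?Y) (\<lambda>(x, y). blinfun_scaleR_left (partial_y f (Complex x y)))"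
      using d(1) unfolding case_prod_unfold continuous_on_eq_continuous_within by auto
  qed (use d(1) in auto)
  then have D: "((\<lambda>p. f (Complex (fst p) (snd p))) has_derivative
      (\<lambda>p. fst p *\<^sub>R partial_x f z + snd p *\<^sub>R partial_y f z)) (at (Re z, Im z))"
    using d(1) unfolding case_prod_unfold by (subst (asm) at_within_open) (auto simp: open_Times)
  have "((\<lambda>w. (Re w, Im w)) has_derivative (\<lambda>w. (Re w, Im w))) (at z)"
    by (auto intro!: derivative_eq_intros)
  from has_derivative_compose[OF this D] show ?thesis by simp
qed

text \<open>Near the point, \<open>f\<close> is recovered from \<open>partial_y f\<close> by integration along vertical segments. Differentiating under
  the integral sign in \<open>x\<close> and then by the upper limit in \<open>y\<close> exchanges the two derivatives.\<close>

lemma C2_on_partials_commute: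
  assumes C2: "C2_on f S" and S: "open S" and z: "z \<in> S"
  shows "partial_y (partial_x f) z = partial_x (partial_y f) z"
proof -
  have C1: "C1_on f S" "C1_on (partial_x f) S" "C1_on (partial_y f) S" using C2 by (auto simp: C2_on_def)
  obtain d where d: "0 < d" "\<And>x y. \<bar>x - Re z\<bar> \<le> d \<Longrightarrow> \<bar>y - Im z\<bar> \<le> d \<Longrightarrow> Complex x y \<in> S"
    using square_subset_open[OF S z] by blast
  define a b where "a = Im z - d" and "b = Im z + d"
  let ?X = "{Re z - d<..<Re z + d}"
  have inS: "Complex x y \<in> S" if "x \<in> ?X" "y \<in> {a..b}" for x y
    using that by (intro d(2)) (auto simp: a_def b_def)
  have rz: "Re z \<in> ?X" using d(1) by simp
  have ab: "Im z \<in> {a<..<b}" using d(1) by (simp add: a_def b_def)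
  have cont: "continuous_on (?X \<times> {a..b}) (\<lambda>p. g (Complex (fst p) (snd p)))" if "continuous_on S g" for g :: "complex \<Rightarrow> complex"
  proof (rule continuous_on_compose2[OF that])
    show "continuous_on (?X \<times> {a..b}) (\<lambda>p. Complex (fst p) (snd p))"
      unfolding Complex_eq by (intro continuous_intros)
  qed (use inS in auto)
  have cont1: "continuous_on {a..b} (\<lambda>t. g (Complex x t))" if "continuous_on S g" "x \<in> ?X" for g :: "complex \<Rightarrow> complex" and x
  proof (rule continuous_on_compose2[OF that(1)])
    show "continuous_on {a..b} (\<lambda>t. Complex x t)"
      unfolding Complex_eq by (intro continuous_intros)
  qed (use inS that in auto)
  have FTC: "f (Complex x y) = f (Complex x a) + integral {a..y} (\<lambda>t. partial_y f (Complex x t))"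
    if "x \<in> ?X" "y \<in> {a..b}" for x y
  proof -
    have "((\<lambda>t. partial_y f (Complex x t)) has_integral f (Complex x y) - f (Complex x a)) {a..y}"
    proof (rule fundamental_theorem_of_calculus)
      fix t assume "t \<in> {a..y}"
      then have "Complex x t \<in> S" using that by (intro inS) auto
      then show "((\<lambda>t. f (Complex x t)) has_vector_derivative partial_y f (Complex x t)) (at t within {a..y})"
        by (rule has_vector_derivative_at_within[OF C1_on_partial_y[OF C1(1)]])
    qed (use that in auto)
    then show ?thesis by (simp add: integral_unique)
  qed
  have px: "partial_x f (Complex (Re z) y) = partial_x f (Complex (Re z) a)
      + integral {a..y} (\<lambda>t. partial_x (partial_y f) (Complex (Re z) t))" if y: "y \<in> {a..b}" for y
  proof -
    have "((\<lambda>x. integral (cbox a y) (\<lambda>t. partial_y f (Complex x t))) has_vector_derivative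
        integral (cbox a y) (\<lambda>t. partial_x (partial_y f) (Complex (Re z) t))) (at (Re z) within ?X)"
    proof (rule leibniz_rule_vector_derivative)
      show "((\<lambda>x. partial_y f (Complex x t)) has_vector_derivative partial_x (partial_y f) (Complex x t)) (at x within ?X)"
        if "x \<in> ?X" "t \<in> cbox a y" for x t
        using that y by (intro has_vector_derivative_at_within[OF C1_on_partial_x[OF C1(3)]] inS) auto
      show "(\<lambda>t. partial_y f (Complex x t)) integrable_on cbox a y" if "x \<in> ?X" for x
        using y cont1[of "partial_y f" x] C1(1) that
        by (intro integrable_continuous continuous_on_subset[OF cont1[of "partial_y f" x]]) (auto simp: C1_on_def)
      show "continuous_on (?X \<times> cbox a y) (\<lambda>(x, t). partial_x (partial_y f) (Complex x t))"
        using y C1(3) unfolding split_beta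
        by (intro continuous_on_subset[OF cont[of "partial_x (partial_y f)"]]) (auto simp: C1_on_def)
    qed (use rz in auto)
    then have I: "((\<lambda>x. integral {a..y} (\<lambda>t. partial_y f (Complex x t))) has_vector_derivative
        integral {a..y} (\<lambda>t. partial_x (partial_y f) (Complex (Re z) t))) (at (Re z))"
      using rz by (subst (asm) at_within_open) auto
    have "a \<in> {a..b}" using ab by auto
    then have "((\<lambda>x. f (Complex x a)) has_vector_derivative partial_x f (Complex (Re z) a)) (at (Re z))"
      using rz by (intro C1_on_partial_x[OF C1(1)] inS)
    from has_vector_derivative_add[OF this I]
    have "((\<lambda>x. f (Complex x y)) has_vector_derivative (partial_x f (Complex (Re z) a)
        + integral {a..y} (\<lambda>t. partial_x (partial_y f) (Complex (Re z) t)))) (at (Re z))"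
    proof (rule has_vector_derivative_transform_within_open[of _ _ _ ?X])
      fix x assume "x \<in> ?X"
      then show "f (Complex x a) + integral {a..y} (\<lambda>t. partial_y f (Complex x t)) = f (Complex x y)"
        by (rule FTC[OF _ y, symmetric])
    qed (use rz in auto)
    moreover have "((\<lambda>x. f (Complex x y)) has_vector_derivative partial_x f (Complex (Re z) y)) (at (Re z))"
      using rz y by (intro C1_on_partial_x[OF C1(1)] inS)
    ultimately show ?thesis by (metis vector_derivative_at)
  qed
  have "((\<lambda>y. integral {a..y} (\<lambda>t. partial_x (partial_y f) (Complex (Re z) t))) has_vector_derivative
      partial_x (partial_y f) (Complex (Re z) (Im z))) (at (Im z) within {a..b})"
    using ab rz C1(3) by (intro integral_has_vector_derivative cont1) (auto simp: C1_on_def)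
  then have "((\<lambda>y. integral {a..y} (\<lambda>t. partial_x (partial_y f) (Complex (Re z) t))) has_vector_derivative
      partial_x (partial_y f) z) (at (Im z))"
    using at_within_interior[of "Im z" "{a..b}"] ab by (simp only: complex_surj interior_atLeastAtMost_real)
  from has_vector_derivative_add[OF has_vector_derivative_const this]
  have "((\<lambda>y. partial_x f (Complex (Re z) a) + integral {a..y} (\<lambda>t. partial_x (partial_y f) (Complex (Re z) t)))
      has_vector_derivative partial_x (partial_y f) z) (at (Im z))" by simp
  then have "((\<lambda>y. partial_x f (Complex (Re z) y)) has_vector_derivative partial_x (partial_y f) z) (at (Im z))"
  proof (rule has_vector_derivative_transform_within_open[of _ _ _ "{a<..<b}"])
    fix y assume "y \<in> {a<..<b}"
    then have "y \<in> {a..b}" by simp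
    from px[OF this] show "partial_x f (Complex (Re z) a) + integral {a..y} (\<lambda>t. partial_x (partial_y f) (Complex (Re z) t))
        = partial_x f (Complex (Re z) y)" by (rule sym)
  qed (use ab in auto)
  moreover have "((\<lambda>y. partial_x f (Complex (Re z) y)) has_vector_derivative partial_y (partial_x f) z) (at (Im z))"
    using C1_on_partial_y[OF C1(2), of "Re z" "Im z"] z by simp
  ultimately show ?thesis by (metis vector_derivative_at)
qed

text \<open>The function \<open>p = (partial_x f - \<i> * partial_y f) / 2\<close> satisfies the Cauchy--Riemann equations: they amount to
  the vanishing of the Laplacian and the symmetry of the mixed derivatives. If \<open>G\<close> is a primitive of \<open>p\<close>, the
  derivative of \<open>f - G\<close> is antilinear, so \<open>cnj (f - G)\<close> is holomorphic.\<close>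

lemma harmonic_eq_holomorphic_plus_cnj_holomorphic:
  assumes f: "f harmonic_on S" and S: "convex S" and c: "c \<in> S"
  obtains g h where "g holomorphic_on S" "h holomorphic_on S" "h c = 0"
    "\<And>z. z \<in> S \<Longrightarrow> f z = g z + cnj (h z)"
proof -
  have oS: "open S" and C2: "C2_on f S" and lap: "\<And>z. z \<in> S \<Longrightarrow> laplacian f z = 0"
    using f by (auto simp: harmonic_on_def)
  have C1: "C1_on f S" "C1_on (partial_x f) S" "C1_on (partial_y f) S" using C2 by (auto simp: C2_on_def)
  define p where "p = (\<lambda>z. (1 / 2) * (partial_x f z - \<i> * partial_y f z))"
  have p: "p holomorphic_on S"
  proof (rule holomorphic_onI)
    fix z assume z: "z \<in> S"
    define u v where "u = partial_x (partial_x f) z" and "v = partial_x (partial_y f) z"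
    have yx: "partial_y (partial_x f) z = v" using C2_on_partials_commute[OF C2 oS z] by (simp add: v_def)
    have yy: "partial_y (partial_y f) z = - u"
      using lap[OF z] unfolding laplacian_def u_def[symmetric] by (rule minus_unique[symmetric])
    have "(p has_derivative (\<lambda>h. (1 / 2) * ((Re h *\<^sub>R u + Im h *\<^sub>R v) - \<i> * (Re h *\<^sub>R v + Im h *\<^sub>R (- u))))) (at z)"
      unfolding p_def
      using C1_on_has_derivative[OF C1(2) oS z] C1_on_has_derivative[OF C1(3) oS z]
      unfolding yx yy u_def[symmetric] v_def[symmetric]
      by (intro has_derivative_mult_right has_derivative_diff)
    also have "(\<lambda>h. (1 / 2) * ((Re h *\<^sub>R u + Im h *\<^sub>R v) - \<i> * (Re h *\<^sub>R v + Im h *\<^sub>R (- u)))) = (*) ((u - \<i> * v) / 2)"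
      by (rule ext) (simp add: complex_eq_iff algebra_simps)
    finally have "(p has_field_derivative (u - \<i> * v) / 2) (at z)" unfolding has_field_derivative_def .
    then show "p field_differentiable (at z within S)"
      using field_differentiable_def has_field_derivative_at_within by blast
  qed
  obtain G where G: "\<And>z. z \<in> S \<Longrightarrow> (G has_field_derivative p z) (at z within S)"
    using holomorphic_convex_primitive'[OF S oS p] by blast
  have G': "(G has_field_derivative p z) (at z)" if "z \<in> S" for z
    using G[OF that] at_within_open[OF that oS] by simp
  define H where "H = (\<lambda>z. cnj (f z - G z))"
  have H: "H holomorphic_on S"
  proof (rule holomorphic_onI)
    fix z assume z: "z \<in> S"
    define a where "a = (partial_x f z + \<i> * partial_y f z) / 2"
    have "(H has_derivative (\<lambda>h. cnj ((Re h *\<^sub>R partial_x f z + Im h *\<^sub>R partial_y f z) - p z * h))) (at z)"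
      unfolding H_def using C1_on_has_derivative[OF C1(1) oS z] G'[OF z, unfolded has_field_derivative_def]
      by (intro has_derivative_cnj has_derivative_diff)
    also have "(\<lambda>h. cnj ((Re h *\<^sub>R partial_x f z + Im h *\<^sub>R partial_y f z) - p z * h)) = (*) (cnj a)"
      by (rule ext) (simp add: complex_eq_iff p_def a_def field_simps)
    finally have "(H has_field_derivative cnj a) (at z)" unfolding has_field_derivative_def .
    then show "H field_differentiable (at z within S)"
      using field_differentiable_def has_field_derivative_at_within by blast
  qed
  show ?thesis
  proof (rule that[of "\<lambda>z. G z + cnj (H c)" "\<lambda>z. H z - H c"])
    have "G holomorphic_on S" using G by (auto simp: holomorphic_on_def field_differentiable_def)
    then show "(\<lambda>z. G z + cnj (H c)) holomorphic_on S" by (intro holomorphic_intros)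
    show "(\<lambda>z. H z - H c) holomorphic_on S" using H by (intro holomorphic_intros)
  qed (auto simp: H_def)
qed

section \<open>The Bergman norm of a harmonic function\<close>

lemma norm_add_cnj_square:
  "norm (a + cnj b) ^ 2 = norm a ^ 2 + norm b ^ 2 + 2 * Re (a * b)"
  unfolding cmod_power2 by (simp add: power2_eq_square algebra_simps)

lemma two_norm_mult_le: "2 * norm (a * b) \<le> norm a ^ 2 + norm (b::complex) ^ 2"
  using sum_squares_bound[of "norm a" "norm b"] by (simp add: norm_mult)

text \<open>The chain of comparisons \<open>f\<close> in the disc, \<open>s\<close> in the disc, \<open>s\<close> on the circle, \<open>f\<close> on the circle, for
  functions that are smooth up to the boundary. The normalisation \<open>h 0 = 0\<close> makes \<open>g * h\<close> vanish at the centre, which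
  removes both correction terms.\<close>

lemma harmonic_disc_le_circle:
  assumes g: "g holomorphic_on ball 0 R" and h: "h holomorphic_on ball 0 R" and R: "1 < R" and h0: "h 0 = 0"
    and n: "2 \<le> n"
  defines "f \<equiv> (\<lambda>z. g z + cnj (h z))"
  shows "(LINT z:unit_disc|lborel. norm (f z) ^ (2 * n))
      \<le> pi * ((1 + cos (pi / (2 * real n))) / (1 - cos (pi / real n))) ^ n * (LINT \<zeta>|arc_measure. norm (f \<zeta>) ^ n) ^ 2"
proof -
  define s where "s = (\<lambda>z. norm (g z) ^ 2 + norm (h z) ^ 2)"
  define q where "q = real n / 2"
  define c where "c = cos (pi / (2 * real n))"
  define b where "b = (1 + c) ^ (n - 1) * sin (pi / (2 * real n))"
  define \<kappa> where "\<kappa> = 1 - cos (pi / real n)"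
  have q: "1 \<le> q" using n by (simp add: q_def)
  have cbR: "cball 0 1 \<subseteq> ball (0::complex) R" using R by (auto simp: subset_eq)
  have gc: "continuous_on (cball 0 1) g" and hc: "continuous_on (cball 0 1) h"
    using cbR by (auto intro!: holomorphic_on_imp_continuous_on holomorphic_on_subset[OF g] holomorphic_on_subset[OF h])
  have sc: "continuous_on (cball 0 1) s" unfolding s_def by (intro continuous_intros gc hc)
  have fc: "continuous_on (cball 0 1) f" unfolding f_def by (intro continuous_intros gc hc)
  have sub: "sphere 0 1 \<subseteq> cball (0::complex) 1" by auto
  have s0: "0 \<le> s z" for z by (simp add: s_def)
  have f2: "norm (f z) ^ 2 = s z + Re (2 * g z * h z)" for z
    by (simp add: f_def norm_add_cnj_square s_def)
  have le_s: "norm (2 * g z * h z) \<le> s z" for z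
    using two_norm_mult_le[of "g z" "h z"] by (simp add: s_def norm_mult mult.assoc)
  have pn: "0 < pi / real n" "pi / real n \<le> pi / 2" "0 < pi / (2 * real n)" "pi / (2 * real n) \<le> pi / 2"
    using n by (auto simp: field_simps)
  have kpos: "0 < \<kappa>"
    using cos_monotone_0_pi[of 0 "pi / real n"] pn pi_gt_zero unfolding \<kappa>_def by simp
  have c0: "0 \<le> c" unfolding c_def using pn by (intro cos_ge_zero) linarith+
  \<comment> \<open>The correction term is the real part of a holomorphic function that vanishes at \<open>0\<close>, so it contributes nothing to
    the area integral.\<close>
  have "(LINT z:unit_disc|lborel. norm (f z) ^ (2 * n))
      \<le> (LINT z:unit_disc|lborel. (1 + c) ^ n * s z ^ n + b * Re ((2 * g z * h z) ^ n))"
  proof (rule set_integral_mono)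
    show "set_integrable lborel unit_disc (\<lambda>z. norm (f z) ^ (2 * n))"
      by (intro integrable_on_disc continuous_intros fc)
    show "set_integrable lborel unit_disc (\<lambda>z. (1 + c) ^ n * s z ^ n + b * Re ((2 * g z * h z) ^ n))"
      by (intro integrable_on_disc continuous_intros sc gc hc)
    show "norm (f z) ^ (2 * n) \<le> (1 + c) ^ n * s z ^ n + b * Re ((2 * g z * h z) ^ n)" for z
      unfolding power_mult f2 b_def c_def by (rule upper_pointwise_inequality[OF n le_s])
  qed
  also have "\<dots> = (1 + c) ^ n * (LINT z:unit_disc|lborel. s z ^ n) + b * (LINT z:unit_disc|lborel. Re ((2 * g z * h z) ^ n))"
  proof -
    have "set_integrable lborel unit_disc (\<lambda>z. (1 + c) ^ n * s z ^ n)"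
      by (intro integrable_on_disc continuous_intros sc)
    moreover have "set_integrable lborel unit_disc (\<lambda>z. b * Re ((2 * g z * h z) ^ n))"
      by (intro integrable_on_disc continuous_intros gc hc)
    ultimately show ?thesis by (simp add: set_integral_add)
  qed
  also have "(LINT z:unit_disc|lborel. Re ((2 * g z * h z) ^ n)) = 0"
  proof -
    have "integrable lborel (\<lambda>z. indicat_real unit_disc z *\<^sub>R (2 * g z * h z) ^ n)"
      by (rule integrable_on_disc[unfolded set_integrable_def]) (intro continuous_intros gc hc)
    then have "(LINT z:unit_disc|lborel. Re ((2 * g z * h z) ^ n)) = Re (LINT z:unit_disc|lborel. (2 * g z * h z) ^ n)"
      unfolding set_lebesgue_integral_def by (subst integral_Re[symmetric]) auto
    also have "(LINT z:unit_disc|lborel. (2 * g z * h z) ^ n) = of_real pi * (2 * g 0 * h 0) ^ n"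
      by (rule disc_integral_holomorphic[OF _ R]) (intro holomorphic_intros g h)
    finally show ?thesis using h0 n by (simp add: zero_power)
  qed
  also have "(LINT z:unit_disc|lborel. s z ^ n) = (LINT z:unit_disc|lborel. s z powr (2 * q))"
    using s0 n by (simp add: q_def powr_realpow')
  also have "\<dots> \<le> pi * (LINT \<zeta>|arc_measure. s \<zeta> powr q) ^ 2"
    unfolding s_def using q by (intro square_sum_isoperimetric[OF g h R]) auto
  finally have upper: "(LINT z:unit_disc|lborel. norm (f z) ^ (2 * n))
      \<le> (1 + c) ^ n * (pi * (LINT \<zeta>|arc_measure. s \<zeta> powr q) ^ 2)"
    using c0 by (simp add: mult_left_mono)
  \<comment> \<open>Here the correction term is a superharmonic power of \<open>- (2 * g z * h z)\<close>, whose mean is not positive.\<close>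
  have lower: "(LINT \<zeta>|arc_measure. s \<zeta> powr q) \<le> (LINT \<zeta>|arc_measure. norm (f \<zeta>) ^ n) / \<kappa> powr q"
  proof -
    define V where "V = (\<lambda>z. superharmonic_power q (- (2 * g z * h z)))"
    define t where "t = \<kappa> powr q * cot (pi / (2 * real n))"
    have t0: "0 \<le> t" unfolding t_def cot_def using pn pi_gt_zero
      by (intro mult_nonneg_nonneg divide_nonneg_nonneg cos_ge_zero sin_ge_zero powr_ge_zero) linarith+
    have Vc: "continuous_on (sphere 0 1) V"
      unfolding V_def using q
      by (intro continuous_on_compose2[OF continuous_superharmonic_power[of q UNIV]] continuous_intros
          continuous_on_subset[OF gc sub] continuous_on_subset[OF hc sub]) auto
    have fnc: "continuous_on (sphere 0 1) (\<lambda>z. norm (f z) ^ n)"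
      by (intro continuous_intros continuous_on_subset[OF fc sub])
    have sqc: "continuous_on (sphere 0 1) (\<lambda>z. s z powr q)"
      using q s0 by (intro continuous_on_powr' continuous_on_subset[OF sc sub] continuous_intros) auto
    have "\<kappa> powr q * (LINT \<zeta>|arc_measure. s \<zeta> powr q) = (LINT \<zeta>|arc_measure. \<kappa> powr q * s \<zeta> powr q)" by simp
    also have "\<dots> \<le> (LINT \<zeta>|arc_measure. norm (f \<zeta>) ^ n + t * V \<zeta>)"
    proof (rule circle_integral_mono)
      fix z :: complex
      have "(s z - Re (- (2 * g z * h z))) powr q = (norm (f z) ^ 2) powr q"
        unfolding f2 by (simp only: uminus_complex.simps diff_minus_eq_add)
      also have "\<dots> = norm (f z) ^ n"
      proof (cases "f z = 0")
        case False
        then have "(norm (f z) ^ 2) powr q = (norm (f z) powr 2) powr q" by (simp add: powr_numeral)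
        also have "\<dots> = norm (f z) powr real n" unfolding powr_powr q_def by simp
        finally show ?thesis using False by (simp add: powr_realpow)
      qed (use n in auto)
      finally show "\<kappa> powr q * s z powr q \<le> norm (f z) ^ n + t * V z"
        using lower_pointwise_inequality[OF n, of "- (2 * g z * h z)" "s z"] le_s[of z]
        unfolding \<kappa>_def q_def t_def V_def by simp
    qed (intro continuous_intros sqc fnc Vc)+
    also have "\<dots> = (LINT \<zeta>|arc_measure. norm (f \<zeta>) ^ n) + t * (LINT \<zeta>|arc_measure. V \<zeta>)"
      using integrable_arc_measure[OF fnc] integrable_arc_measure[OF Vc] by simp
    also have "\<dots> \<le> (LINT \<zeta>|arc_measure. norm (f \<zeta>) ^ n)"
    proof -
      have "(LINT \<zeta>|arc_measure. V \<zeta>) \<le> 0"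
        unfolding V_def
      proof (rule circle_mean_superharmonic_power_le_0[OF q R])
        show "(\<lambda>z. - (2 * g z * h z)) holomorphic_on ball 0 R" by (intro holomorphic_intros g h)
      qed (use h0 in simp)
      then show ?thesis using t0 by (simp add: mult_nonneg_nonpos)
    qed
    finally show ?thesis using kpos by (simp add: field_simps)
  qed
  have "0 \<le> (LINT \<zeta>|arc_measure. s \<zeta> powr q)" by (intro integral_nonneg_AE AE_I2) simp
  then have "(1 + c) ^ n * (pi * (LINT \<zeta>|arc_measure. s \<zeta> powr q) ^ 2)
      \<le> (1 + c) ^ n * (pi * ((LINT \<zeta>|arc_measure. norm (f \<zeta>) ^ n) / \<kappa> powr q) ^ 2)"
    using c0 by (intro mult_left_mono power_mono lower) auto
  note order_trans[OF upper this]
  also have "\<dots> = pi * ((1 + c) / \<kappa>) ^ n * (LINT \<zeta>|arc_measure. norm (f \<zeta>) ^ n) ^ 2"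
  proof -
    have "(\<kappa> powr q) ^ 2 = \<kappa> ^ n"
      using kpos by (simp add: powr_power q_def powr_realpow)
    then show ?thesis by (simp add: power_divide)
  qed
  finally show ?thesis unfolding c_def \<kappa>_def .
qed

lemma sharp_constant_eq:
  assumes n: "2 \<le> n"
  shows "(1 + cos (pi / (2 * real n))) / (1 - cos (pi / real n)) = (1 / 2 * (1 / sin (pi / (4 * real n)))) ^ 2"
proof -
  define \<beta> where "\<beta> = pi / (4 * real n)"
  have \<beta>: "pi / (2 * real n) = 2 * \<beta>" "pi / real n = 2 * (2 * \<beta>)" by (auto simp: \<beta>_def)
  have b: "0 < \<beta>" "\<beta> < pi / 2" using n by (auto simp: \<beta>_def field_simps)
  have pos: "0 < sin \<beta>" "0 < cos \<beta>" using b by (auto intro!: sin_gt_zero cos_gt_zero)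
  have A: "1 - cos (2 * (2 * \<beta>)) = 2 * (2 * sin \<beta> * cos \<beta>) ^ 2" by (simp only: cos_double_sin sin_double)
  have B: "1 + cos (2 * \<beta>) = 2 * cos \<beta> ^ 2" by (simp add: cos_double_cos)
  show ?thesis
    unfolding \<beta> \<beta>_def[symmetric] A B using pos by (simp add: field_simps power2_eq_square)
qed

theorem theorem2p11:
  fixes n :: nat and f :: "complex \<Rightarrow> complex"
  assumes "n \<ge> 2"
    and "f harmonic_on unit_disc"
    and "f \<in> h_space (real n)"
  shows "f \<in> b_space (2 * real n) \<and>
         b_norm (2 * real n) f \<le> 1 / 2 * (1 / sin (pi / (4 * real n))) * h_norm (real n) f"
proof -
  define C where "C = 1 / 2 * (1 / sin (pi / (4 * real n)))"
  define H where "H = h_norm (real n) f"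
  have n: "2 \<le> n" by fact
  have C0: "0 \<le> C" unfolding C_def using n by (auto intro!: sin_ge_zero simp: field_simps)
  obtain g h where gh: "g holomorphic_on unit_disc" "h holomorphic_on unit_disc" "h 0 = 0"
      "\<And>z. z \<in> unit_disc \<Longrightarrow> f z = g z + cnj (h z)"
    using harmonic_eq_holomorphic_plus_cnj_holomorphic[OF assms(2) convex_ball, of 0] by auto
  have fcont: "continuous_on unit_disc f"
    by (subst continuous_on_cong[OF refl gh(4)])
      (auto intro!: continuous_on_add continuous_on_cnj intro: holomorphic_on_imp_continuous_on gh(1,2))
  have bdd: "bdd_above (integral_mean (real n) f ` {0<..<1})" using assms(3) by (simp add: h_space_def)
  have mean_le: "integral_mean (real n) f r \<le> H" if "0 < r" "r < 1" for r
    unfolding H_def h_norm_def using that by (intro cSUP_upper bdd) auto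
  have H0: "0 \<le> H" using mean_le[of "1/2"] by (rule order_trans[rotated]) (auto simp: integral_mean_def)
  define L where "L = pi * (C * H) ^ (2 * n)"
  have dilate: "(LINT z:unit_disc|lborel. norm (f (of_real r * z)) ^ (2 * n)) \<le> L"
    and dilate_int: "set_integrable lborel unit_disc (\<lambda>z. norm (f (of_real r * z)) ^ (2 * n))"
    if r: "0 < r" "r < 1" for r
  proof -
    define G where "G = (\<lambda>z. g (of_real r * z))"
    define K where "K = (\<lambda>z. h (of_real r * z))"
    have img: "of_real r * z \<in> unit_disc" if "norm z < 1 / r" for z :: complex
      using that r by (simp add: norm_mult field_simps)
    have "(g \<circ> (\<lambda>z. of_real r * z)) holomorphic_on ball 0 (1 / r)"
      by (rule holomorphic_on_compose_gen[OF _ gh(1)]) (use img in \<open>auto intro!: holomorphic_intros\<close>)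
    then have G: "G holomorphic_on ball 0 (1 / r)" by (simp add: G_def comp_def)
    have "(h \<circ> (\<lambda>z. of_real r * z)) holomorphic_on ball 0 (1 / r)"
      by (rule holomorphic_on_compose_gen[OF _ gh(2)]) (use img in \<open>auto intro!: holomorphic_intros\<close>)
    then have K: "K holomorphic_on ball 0 (1 / r)" by (simp add: K_def comp_def)
    have R: "1 < 1 / r" using r by simp
    have eq: "f (of_real r * z) = G z + cnj (K z)" if "norm z \<le> 1" for z
      using gh(4)[OF img, of z] that R by (simp add: G_def K_def)
    define m where "m = (LINT \<zeta>|arc_measure. norm (f (of_real r * \<zeta>)) powr real n)"
    have m0: "0 \<le> m" unfolding m_def by (intro integral_nonneg_AE AE_I2) simp
    have cont: "continuous_on (cball 0 1) (\<lambda>z. f (of_real r * z))"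
      by (rule continuous_on_compose2[OF fcont]) (use img R in \<open>auto intro!: continuous_intros\<close>)
    show "set_integrable lborel unit_disc (\<lambda>z. norm (f (of_real r * z)) ^ (2 * n))"
      by (intro integrable_on_disc continuous_intros cont)
    have "(LINT z:unit_disc|lborel. norm (f (of_real r * z)) ^ (2 * n)) = (LINT z:unit_disc|lborel. norm (G z + cnj (K z)) ^ (2 * n))"
      by (intro set_lebesgue_integral_cong) (auto simp: eq)
    also have "\<dots> \<le> pi * ((1 + cos (pi / (2 * real n))) / (1 - cos (pi / real n))) ^ n * (LINT \<zeta>|arc_measure. norm (G \<zeta> + cnj (K \<zeta>)) ^ n) ^ 2"
      by (rule harmonic_disc_le_circle[OF G K R _ n]) (simp add: K_def gh(3))
    also have "(LINT \<zeta>|arc_measure. norm (G \<zeta> + cnj (K \<zeta>)) ^ n) = m"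
      unfolding m_def using n
      by (intro Bochner_Integration.integral_cong) (auto simp: arc_measure_def space_restrict_space eq powr_realpow')
    also have "((1 + cos (pi / (2 * real n))) / (1 - cos (pi / real n))) ^ n = C ^ (2 * n)"
      unfolding sharp_constant_eq[OF n] C_def by (simp only: power_mult)
    also have "m ^ 2 \<le> (H ^ n) ^ 2"
    proof (rule power_mono[OF _ m0])
      have "m powr (1 / real n) \<le> H" using mean_le[OF r] by (simp add: integral_mean_def m_def)
      then have "(m powr (1 / real n)) ^ n \<le> H ^ n" by (intro power_mono) auto
      also have "(m powr (1 / real n)) ^ n = (m powr (1 / real n)) powr real n" using n by (simp add: powr_realpow')
      also have "\<dots> = m" using n m0 by (simp add: powr_powr)
      finally show "m \<le> H ^ n" .
    qed
    also have "pi * C ^ (2 * n) * (H ^ n) ^ 2 = L"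
      by (simp add: L_def power_mult_distrib power_mult[symmetric] mult.commute)
    finally show "(LINT z:unit_disc|lborel. norm (f (of_real r * z)) ^ (2 * n)) \<le> L"
      using C0 by (simp add: mult_left_mono)
  qed
  define r where "r = (\<lambda>k. 1 - inverse (real (Suc (Suc k))))"
  have r: "0 < r k" "r k < 1" for k by (auto simp: r_def field_simps)
  have rlim: "r \<longlonglongrightarrow> 1"
    using LIMSEQ_Suc[OF LIMSEQ_inverse_real_of_nat] unfolding r_def
    by (rule tendsto_eq_rhs[OF tendsto_diff[OF tendsto_const]]) simp
  have fmeas: "(\<lambda>z. indicat_real unit_disc z *\<^sub>R norm (f z) ^ (2 * n)) \<in> borel_measurable borel"
    by (intro borel_measurable_continuous_on_indicator continuous_intros fcont) simp
  have L0: "0 \<le> L" unfolding L_def using C0 H0 by simp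
  have "(\<integral>\<^sup>+z. ennreal (indicat_real unit_disc z *\<^sub>R norm (f z) ^ (2 * n)) \<partial>lborel)
      \<le> (\<integral>\<^sup>+z. liminf (\<lambda>k. ennreal (indicat_real unit_disc z *\<^sub>R norm (f (of_real (r k) * z)) ^ (2 * n))) \<partial>lborel)"
  proof (rule nn_integral_mono)
    fix z :: complex
    have "(\<lambda>k. ennreal (indicat_real unit_disc z *\<^sub>R norm (f (of_real (r k) * z)) ^ (2 * n)))
        \<longlonglongrightarrow> ennreal (indicat_real unit_disc z *\<^sub>R norm (f z) ^ (2 * n))"
    proof (cases "z \<in> unit_disc")
      case True
      have "isCont f z" using fcont True by (simp add: continuous_on_eq_continuous_at)
      moreover have "(\<lambda>k. of_real (r k) * z) \<longlonglongrightarrow> of_real 1 * z" by (intro tendsto_intros rlim)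
      ultimately have "(\<lambda>k. f (of_real (r k) * z)) \<longlonglongrightarrow> f z" by (intro isCont_tendsto_compose[of z f]) auto
      then show ?thesis by (intro tendsto_ennrealI tendsto_intros)
    qed simp
    from lim_imp_Liminf[OF trivial_limit_sequentially this]
    show "ennreal (indicat_real unit_disc z *\<^sub>R norm (f z) ^ (2 * n))
        \<le> liminf (\<lambda>k. ennreal (indicat_real unit_disc z *\<^sub>R norm (f (of_real (r k) * z)) ^ (2 * n)))"
      by (simp only: order_refl)
  qed
  also have "\<dots> \<le> liminf (\<lambda>k. \<integral>\<^sup>+z. ennreal (indicat_real unit_disc z *\<^sub>R norm (f (of_real (r k) * z)) ^ (2 * n)) \<partial>lborel)"
    using dilate_int[OF r] by (intro nn_integral_liminf) (auto simp: set_integrable_def)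
  also have "\<dots> \<le> liminf (\<lambda>k. ennreal L)"
  proof (intro Liminf_mono always_eventually allI)
    fix k
    have "(\<integral>\<^sup>+z. ennreal (indicat_real unit_disc z *\<^sub>R norm (f (of_real (r k) * z)) ^ (2 * n)) \<partial>lborel)
        = ennreal (LINT z:unit_disc|lborel. norm (f (of_real (r k) * z)) ^ (2 * n))"
      unfolding set_lebesgue_integral_def
      by (rule nn_integral_eq_integral[OF dilate_int[OF r, unfolded set_integrable_def]]) simp
    also have "\<dots> \<le> ennreal L" by (intro ennreal_leI dilate r)
    finally show "(\<integral>\<^sup>+z. ennreal (indicat_real unit_disc z *\<^sub>R norm (f (of_real (r k) * z)) ^ (2 * n)) \<partial>lborel) \<le> ennreal L" .
  qed
  also have "\<dots> = ennreal L" by (simp add: Liminf_const)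
  finally have nn: "(\<integral>\<^sup>+z. ennreal (indicat_real unit_disc z *\<^sub>R norm (f z) ^ (2 * n)) \<partial>lborel) \<le> ennreal L" .
  have int: "integrable lborel (\<lambda>z. indicat_real unit_disc z *\<^sub>R norm (f z) ^ (2 * n))"
  proof (rule integrableI_nonneg)
    show "(\<integral>\<^sup>+z. ennreal (indicat_real unit_disc z *\<^sub>R norm (f z) ^ (2 * n)) \<partial>lborel) < \<infinity>"
      using nn by (rule order_le_less_trans) simp
  qed (use fmeas in auto)
  have le: "(LINT z:unit_disc|lborel. norm (f z) ^ (2 * n)) \<le> L"
    using nn L0 unfolding set_lebesgue_integral_def
    by (subst (asm) nn_integral_eq_integral[OF int]) auto
  have pw: "norm (f z) powr (2 * real n) = norm (f z) ^ (2 * n)" for z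
    using n powr_realpow'[of "norm (f z)" "2 * n"] by simp
  have "f \<in> b_space (2 * real n)"
    using assms(2) int by (simp add: b_space_def pw set_integrable_def)
  moreover have "b_norm (2 * real n) f \<le> C * H"
  proof -
    have "(LINT z:unit_disc|lborel. norm (f z) powr (2 * real n) / pi) = (LINT z:unit_disc|lborel. norm (f z) ^ (2 * n)) / pi"
      unfolding pw by simp
    also have "\<dots> \<le> (C * H) ^ (2 * n)" using le by (simp add: L_def field_simps)
    finally have "b_norm (2 * real n) f \<le> ((C * H) ^ (2 * n)) powr (1 / (2 * real n))"
      unfolding b_norm_def by (intro powr_mono2) (auto intro!: integral_nonneg_AE AE_I2 simp: set_lebesgue_integral_def)
    also have "\<dots> = C * H"
    proof (cases "C * H = 0")
      case False
      then have "0 < C * H" using C0 H0 by (simp add: less_eq_real_def)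
      then have "((C * H) ^ (2 * n)) powr (1 / (2 * real n)) = (C * H) powr (real (2 * n) * (1 / (2 * real n)))"
        by (simp only: powr_realpow[symmetric] powr_powr)
      also have "real (2 * n) * (1 / (2 * real n)) = 1" using n by simp
      finally show ?thesis using \<open>0 < C * H\<close> by simp
    qed (use n in \<open>auto simp: zero_power\<close>)
    finally show ?thesis .
  qed
  ultimately show ?thesis unfolding C_def H_def by blast
qed

end
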